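(* Consider the hexagonal network under Model 2 with both Tx- and Rx-cooperation and an unlimited number of cooperation rounds ($D=\infty$), as defined in the context. For $\rho\in(0,1]$ and $\rho_f\in[0,1]$, the fundamental MG region $\mathcal S_2^\star(D=\infty,\rho,\rho_f)$ includes all nonnegative pairs $(S^{(U)},S^{(e)})$ satisfying $$S^{(U)}\le\frac{\rho\rho_f}{3},\qquad S^{(e)}\le\rho(1-\rho_f).$$
   Context: Hexagonal network: for each $K$ there are $K$ hexagonal cells indexed by $\mathcal K=\{1,\dots,K\}$, each with one transmitter (Tx) and one receiver (Rx). Cell $k$ has position $o_k=a_k\mathbf e_x+b_k\mathbf e_y$ in the complex plane with distinct integer pairs $(a_k,b_k)$, where $\mathbf e_x=\frac{\sqrt3}{2}-\frac12 i$ and $\mathbf e_y=i$. The neighbour set and interference set of $k$ coincide: $\mathcal N_k=\mathcal I_k$ is the set of the (at most six) adjacent cells $k'\in\mathcal K$, i.e. those with $(a_k-a_{k'},b_k-b_{k'})\in\{\pm(1,0),\pm(0,1),\pm(1,1)\}$ (equivalently $|o_k-o_{k'}|=1$). Activity. Each Tx $k$ is active ($A_k=1$) with probability $\rho$, independently over $k$, and $A_k=0$ otherwise. Given that Tx $k$ is active, $B_k=1$ with probability $\rho_f$, independently of everything else, and $B_k=0$ otherwise. Let $\mathcal K_{active}=\{k:A_k=1\}$, $\mathcal K_{URLLC}=\{k:A_k=1,B_k=1\}$. Model 2: each Tx in $\mathcal K_{URLLC}$ has only a URLLC message, and each Tx in $\mathcal K_{eMBB}=\mathcal K_{active}\setminus\mathcal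 K_{URLLC}$ has only an eMBB message. Write $\mathbf A,\mathbf B$ for the activity tuples; all terminals know $(\mathbf A,\mathbf B)$. Messages. For blocklength $n$, the eMBB message $M_k^{(e)}$ ($k\in\mathcal K_{eMBB}$) is uniform on $\{1,\dots,\lfloor 2^{nR_k^{(e)}}\rfloor\}$, where $R_k^{(e)}$ may depend on $k$ and on $(\mathbf A,\mathbf B)$. The URLLC message $M_k^{(U)}$ ($k\in\mathcal K_{URLLC}$) is uniform on $\{1,\dots,\lfloor 2^{nR^{(U)}}\rfloor\}$, with the same rate $R^{(U)}$ for all $k$, not depending on $(\mathbf A,\mathbf B)$. Messages are independent. Channel. For $t=1,\dots,n$, $Y_{k,t}=h_{k,k}X_{k,t}+\sum_{\tilde k\in\mathcal I_k}h_{\tilde k,k}X_{\tilde k,t}+Z_{k,t}$, where inactive Txs send zero, the $h_{\tilde k,k}\ge 0$ are fixed real numbers, and the $Z_{k,t}$ are i.i.d. standard Gaussian, independent of all messages. Communication with both Tx- and Rx-cooperation; $D=\infty$ means that the numbers of Tx- and Rx-cooperation rounds may be any finite numbers. (i) Tx-cooperation rounds: in each round every active Tx $k$ sends to each active neighbour in $\mathcal N_k$ over a noise-free link of unlimited capacity an arbitrary function of its eMBB message (if it has one), the cooperation messages it received in previous rounds, and $(\mathbf A,\mathbf B)$ (not of URLLC messages). (ii) Each active Tx $k$ computes $X_k^n$ as a function of its own message, all cooperation messages it received, and $(\mathbf A,\mathbf B)$, subject to $\frac1n\sum_{t=1}^n X_{k,t}^2\le P$ almost surely. (iii) Each Rx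 $k\in\mathcal K_{URLLC}$ decodes $M_k^{(U)}$ from $Y_k^n$ and $(\mathbf A,\mathbf B)$ only. (iv) Rx-cooperation rounds: in each round every active Rx $k$ sends to each active neighbour in $\mathcal N_k$ over a noise-free link of unlimited capacity an arbitrary function of $Y_k^n$, the cooperation messages it received in previous rounds, and $(\mathbf A,\mathbf B)$. (v) Each Rx $k\in\mathcal K_{eMBB}$ decodes $M_k^{(e)}$ from $Y_k^n$, all cooperation messages it received, and $(\mathbf A,\mathbf B)$. Achievability. For given $P,K$, a pair $(R^{(U)}(P),\bar R_K^{(e)}(P))$ is achievable if there exist rates $R_k^{(e)}$ with $\bar R_K^{(e)}\le \mathbb E_{\mathbf A,\mathbf B}\big[\frac1K\sum_{k\in\mathcal K_{eMBB}}R_k^{(e)}\big]$ and, for some finite numbers of Tx- and Rx-cooperation rounds, Tx-cooperation functions (of the own eMBB message if there is one, the previously received Tx-cooperation messages and $(\mathbf A,\mathbf B)$), encoding functions (of the own message, the received Tx-cooperation messages and $(\mathbf A,\mathbf B)$, obeying the power constraint $\frac1n\sum_{t=1}^n X_{k,t}^2\le P$ almost surely), URLLC decoding functions (of $Y_k^n$ and $(\mathbf A,\mathbf B)$), Rx-cooperation functions (of $Y_k^n$, the previously received Rx-cooperation messages and $(\mathbf A,\mathbf B)$) and eMBB decoding functions (of $Y_k^n$, all received Rx-cooperation messages and $(\mathbf A,\mathbf B)$) such that the probability that some URLLC message ($k\in\mathcal K_{URLLC}$) or some eMBB message ($k\in\mathcal K_{eMBB}$) is decoded incorrectly tends to $0$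 as $n\to\infty$. A multiplexing gain (MG) pair $(S^{(U)},S^{(e)})$ is achievable if for all $P>0$ (and all $K$) there exist achievable rates with $S^{(U)}=\rho\rho_f\,\varlimsup_{K\to\infty}\varlimsup_{P\to\infty}\frac{R^{(U)}(P)}{\frac12\log P}$ and $S^{(e)}=\varlimsup_{K\to\infty}\varlimsup_{P\to\infty}\frac{\bar R_K^{(e)}(P)}{\frac12\log P}$. The fundamental MG region $\mathcal S_2^\star(D=\infty,\rho,\rho_f)$ is the closure of the set of all achievable MG pairs under Model 2.
   Formalization: The formal theorem additionally assumes that every principal submatrix of the channel matrix (own and neighbour gains h) is invertible, which holds for almost all gains; for arbitrary fixed h ≥ 0, e.g. all h = 0, the claim is false. *)

theory Defs
  imports "HOL-Probability.Probability"
begin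

record hex_network =
  ncells :: nat
  xcoord :: "nat \<Rightarrow> int"
  ycoord :: "nat \<Rightarrow> int"
  gain :: "nat \<Rightarrow> nat \<Rightarrow> real"  \<comment> \<open>from Tx (first argument) to Rx (second argument)\<close>

definition cells :: "hex_network \<Rightarrow> nat set" where
  "cells N = {1..ncells N}"

definition e_x :: complex where "e_x = Complex (sqrt 3 / 2) (- 1 / 2)"
definition e_y :: complex where "e_y = \<i>"

definition cell_position :: "hex_network \<Rightarrow> nat \<Rightarrow> complex" where
  "cell_position N k = of_int (xcoord N k) * e_x + of_int (ycoord N k) * e_y"

definition neighbours :: "hex_network \<Rightarrow> nat \<Rightarrow> nat set" where
  "neighbours N k = {j \<in> cells N. (xcoord N k - xcoord N j, ycoord N k - ycoord N j) \<in>
     {(1,0), (-1,0), (0,1), (0,-1), (1,1), (-1,-1)}}"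

lemma neighbours_iff_unit_distance:
  "j \<in> neighbours N k \<longleftrightarrow> j \<in> cells N \<and> cmod (cell_position N k - cell_position N j) = 1"
proof -
  define a b where "a = xcoord N k - xcoord N j" and "b = ycoord N k - ycoord N j"
  have d: "cell_position N k - cell_position N j = of_int a * e_x + of_int b * e_y"
    by (simp add: cell_position_def a_def b_def algebra_simps)
  have sq3: "sqrt 3 * sqrt 3 = (3::real)" by simp
  have "(cmod (of_int a * e_x + of_int b * e_y))\<^sup>2 = of_int (a * a - a * b + b * b)"
    unfolding cmod_power2 using sq3
    by (simp add: e_x_def e_y_def power2_eq_square field_simps)
  then have norm_iff: "cmod (of_int a * e_x + of_int b * e_y) = 1 \<longleftrightarrow> a * a - a * b + b * b = 1"
    by (metis norm_ge_zero of_int_1 of_int_eq_iff one_power2 power2_eq_iff_nonneg zero_le_one)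
  have "a * a - a * b + b * b = 1 \<longleftrightarrow> (a, b) \<in> {(1,0), (-1,0), (0,1), (0,-1), (1,1), (-1,-1)}"
  proof
    assume q: "a * a - a * b + b * b = 1"
    have "(2 * a - b)\<^sup>2 + 3 * b\<^sup>2 = 4" "(2 * b - a)\<^sup>2 + 3 * a\<^sup>2 = 4"
      using q by (simp_all add: power2_eq_square algebra_simps)
    then have "3 * b\<^sup>2 \<le> 4" "3 * a\<^sup>2 \<le> 4"
      by (smt (verit) zero_le_power2)+
    then have "b\<^sup>2 \<le> 1" "a\<^sup>2 \<le> 1" by linarith+
    then have "\<bar>b\<bar> \<le> 1" "\<bar>a\<bar> \<le> 1" by (simp_all add: abs_square_le_1)
    then have "a \<in> {-1, 0, 1}" "b \<in> {-1, 0, 1}" by auto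
    with q show "(a, b) \<in> {(1,0), (-1,0), (0,1), (0,-1), (1,1), (-1,-1)}" by auto
  qed auto
  then show ?thesis
    using d norm_iff by (simp add: neighbours_def a_def b_def)
qed

definition hexagonal_network :: "hex_network \<Rightarrow> bool" where
  "hexagonal_network N \<longleftrightarrow>
     inj_on (\<lambda>k. (xcoord N k, ycoord N k)) (cells N) \<and>
     (\<forall>j\<in>cells N. \<forall>k\<in>cells N. 0 \<le> gain N j k)"

definition channel_matrix :: "hex_network \<Rightarrow> nat \<Rightarrow> nat \<Rightarrow> real" where
  "channel_matrix N j k = (if j = k \<or> j \<in> neighbours N k then gain N j k else 0)"

text \<open>Every principal submatrix of the channel matrix is invertible (has trivial kernel).
  This holds for Lebesgue-almost every choice of the gains. Some such condition is needed:
  two adjacent active cells without further active neighbours and with all gains equal to 1 have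
  a joint channel of rank one, hence a sum multiplexing gain of at most 1 and not 2.\<close>

definition nondegenerate :: "hex_network \<Rightarrow> bool" where
  "nondegenerate N \<longleftrightarrow>
     (\<forall>S \<subseteq> cells N. \<forall>x :: nat \<Rightarrow> real.
        (\<forall>k\<in>S. (\<Sum>j\<in>S. channel_matrix N j k * x j) = 0) \<longrightarrow> (\<forall>j\<in>S. x j = 0))"

type_synonym activity = "nat \<Rightarrow> bool \<times> bool"

definition cell_activity_pmf :: "real \<Rightarrow> real \<Rightarrow> (bool \<times> bool) pmf" where
  "cell_activity_pmf \<rho> \<rho>\<^sub>f =
     bind_pmf (bernoulli_pmf \<rho>) (\<lambda>A.
       map_pmf (Pair A) (if A then bernoulli_pmf \<rho>\<^sub>f else return_pmf False))"

definition activity_pmf :: "real \<Rightarrow> real \<Rightarrow> hex_network \<Rightarrow> activity pmf" where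
  "activity_pmf \<rho> \<rho>\<^sub>f N = Pi_pmf (cells N) (False, False) (\<lambda>_. cell_activity_pmf \<rho> \<rho>\<^sub>f)"

definition active :: "hex_network \<Rightarrow> activity \<Rightarrow> nat set" where
  "active N s = {k \<in> cells N. fst (s k)}"

definition urllc :: "hex_network \<Rightarrow> activity \<Rightarrow> nat set" where
  "urllc N s = {k \<in> cells N. fst (s k) \<and> snd (s k)}"

definition embb :: "hex_network \<Rightarrow> activity \<Rightarrow> nat set" where
  "embb N s = active N s - urllc N s"

definition active_neighbours :: "hex_network \<Rightarrow> activity \<Rightarrow> nat \<Rightarrow> nat set" where
  "active_neighbours N s k = neighbours N k \<inter> active N s"

text \<open>In this model every active cell has exactly one message, so a message tuple is a single
  function; its value is 0, which is not a message, at inactive cells.\<close>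

definition message_pmf ::
    "hex_network \<Rightarrow> nat \<Rightarrow> real \<Rightarrow> (activity \<Rightarrow> nat \<Rightarrow> real) \<Rightarrow> activity \<Rightarrow> (nat \<Rightarrow> nat) pmf" where
  "message_pmf N n RU RE s = Pi_pmf (active N s) 0 (\<lambda>k.
     pmf_of_set {1..nat \<lfloor>2 powr (real n * (if k \<in> urllc N s then RU else RE s k))\<rfloor>})"

definition source_pmf ::
    "real \<Rightarrow> real \<Rightarrow> hex_network \<Rightarrow> nat \<Rightarrow> real \<Rightarrow> (activity \<Rightarrow> nat \<Rightarrow> real) \<Rightarrow>
     (activity \<times> (nat \<Rightarrow> nat)) pmf" where
  "source_pmf \<rho> \<rho>\<^sub>f N n RU RE =
     bind_pmf (activity_pmf \<rho> \<rho>\<^sub>f N) (\<lambda>s. map_pmf (Pair s) (message_pmf N n RU RE s))"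

definition noise :: "hex_network \<Rightarrow> nat \<Rightarrow> (nat \<times> nat \<Rightarrow> real) measure" where
  "noise N n = (\<Pi>\<^sub>M p\<in>cells N \<times> {1..n}. density lborel std_normal_density)"

text \<open>What a terminal has received: one entry per past round, mapping each sender to its
  message (\<open>None\<close> if that cell sends nothing to the terminal).\<close>

type_synonym 'm history = "(nat \<Rightarrow> 'm option) list"

text \<open>\<open>f j k\<close> is the rule by which \<open>j\<close> forms its message to \<open>k\<close> from its history; the
  current round number is the length of that history.\<close>

fun received ::
    "(nat \<Rightarrow> nat set) \<Rightarrow> (nat \<Rightarrow> nat \<Rightarrow> 'm history \<Rightarrow> 'm) \<Rightarrow> nat \<Rightarrow> nat \<Rightarrow> 'm history" where
  "received nb f 0 k = []"
| "received nb f (Suc r) k =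
     received nb f r k @ [\<lambda>j. if j \<in> nb k then Some (f j k (received nb f r j)) else None]"

text \<open>Links have unlimited capacity. The two alphabets below are large enough for this to be
  no restriction: at a fixed blocklength a Tx-cooperation message takes finitely many values,
  and an Rx-cooperation message, being a function of finitely many reals, at most
  continuum many.\<close>

type_synonym tx_msg = "nat \<Rightarrow> nat"
type_synonym rx_msg = "nat \<Rightarrow> nat \<Rightarrow> real"

record code =
  tx_coop :: "activity \<Rightarrow> nat \<Rightarrow> nat \<Rightarrow> nat option \<Rightarrow> tx_msg history \<Rightarrow> tx_msg"
  encode :: "activity \<Rightarrow> nat \<Rightarrow> nat \<Rightarrow> tx_msg history \<Rightarrow> nat \<Rightarrow> real"
  urllc_decode :: "activity \<Rightarrow> nat \<Rightarrow> (nat \<Rightarrow> real) \<Rightarrow> nat"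
  rx_coop :: "activity \<Rightarrow> nat \<Rightarrow> nat \<Rightarrow> (nat \<Rightarrow> real) \<Rightarrow> rx_msg history \<Rightarrow> rx_msg"
  embb_decode :: "activity \<Rightarrow> nat \<Rightarrow> (nat \<Rightarrow> real) \<Rightarrow> rx_msg history \<Rightarrow> nat"

definition channel_input ::
    "hex_network \<Rightarrow> code \<Rightarrow> nat \<Rightarrow> activity \<Rightarrow> (nat \<Rightarrow> nat) \<Rightarrow> nat \<Rightarrow> nat \<Rightarrow> real" where
  "channel_input N c DT s m k t =
     (if k \<in> active N s
      then encode c s k (m k)
             (received (active_neighbours N s)
                (\<lambda>j i. tx_coop c s j i (if j \<in> embb N s then Some (m j) else None)) DT k) t
      else 0)"

text \<open>The output block is restricted to times \<open>1..n\<close>, because the power constraint does not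
  control the inputs at other times.\<close>

definition channel_output ::
    "hex_network \<Rightarrow> nat \<Rightarrow> (nat \<Rightarrow> nat \<Rightarrow> real) \<Rightarrow> (nat \<times> nat \<Rightarrow> real) \<Rightarrow> nat \<Rightarrow> nat \<Rightarrow> real" where
  "channel_output N n X z k = (\<lambda>t\<in>{1..n}.
     gain N k k * X k t + (\<Sum>j\<in>neighbours N k. gain N j k * X j t) + z (k, t))"

definition decision ::
    "hex_network \<Rightarrow> code \<Rightarrow> nat \<Rightarrow> activity \<Rightarrow> (nat \<Rightarrow> nat \<Rightarrow> real) \<Rightarrow> nat \<Rightarrow> nat" where
  "decision N c DR s y k =
     (if k \<in> urllc N s then urllc_decode c s k (y k)
      else embb_decode c s k (y k)
             (received (active_neighbours N s) (\<lambda>j i. rx_coop c s j i (y j)) DR k))"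

definition wrong_at ::
    "hex_network \<Rightarrow> nat \<Rightarrow> code \<Rightarrow> nat \<Rightarrow> nat \<Rightarrow> activity \<Rightarrow> (nat \<Rightarrow> nat) \<Rightarrow> nat \<Rightarrow>
     (nat \<times> nat \<Rightarrow> real) set" where
  "wrong_at N n c DT DR s m k = {z \<in> space (noise N n).
     decision N c DR s (channel_output N n (channel_input N c DT s m) z) k \<noteq> m k}"

definition power_constraint ::
    "real \<Rightarrow> real \<Rightarrow> hex_network \<Rightarrow> real \<Rightarrow> nat \<Rightarrow> real \<Rightarrow> (activity \<Rightarrow> nat \<Rightarrow> real) \<Rightarrow> nat \<Rightarrow> code \<Rightarrow> bool"
  where
  "power_constraint \<rho> \<rho>\<^sub>f N P n RU RE DT c \<longleftrightarrow>
     (AE (s, m) in measure_pmf (source_pmf \<rho> \<rho>\<^sub>f N n RU RE). \<forall>k\<in>active N s.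
        1 / real n * (\<Sum>t=1..n. (channel_input N c DT s m k t)\<^sup>2) \<le> P)"

text \<open>The maps of a code are arbitrary functions, so it must be required that the decoding errors
  are events.\<close>

definition errors_measurable ::
    "real \<Rightarrow> real \<Rightarrow> hex_network \<Rightarrow> nat \<Rightarrow> real \<Rightarrow> (activity \<Rightarrow> nat \<Rightarrow> real) \<Rightarrow>
     nat \<Rightarrow> nat \<Rightarrow> code \<Rightarrow> bool" where
  "errors_measurable \<rho> \<rho>\<^sub>f N n RU RE DT DR c \<longleftrightarrow>
     (\<forall>(s, m) \<in> set_pmf (source_pmf \<rho> \<rho>\<^sub>f N n RU RE). \<forall>k\<in>active N s.
        wrong_at N n c DT DR s m k \<in> sets (noise N n))"

text \<open>An iterated integral instead of a product measure: the product of a discrete space over an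
  uncountable type with the noise need not make the error set measurable.\<close>

definition error_prob ::
    "real \<Rightarrow> real \<Rightarrow> hex_network \<Rightarrow> nat \<Rightarrow> real \<Rightarrow> (activity \<Rightarrow> nat \<Rightarrow> real) \<Rightarrow>
     nat \<Rightarrow> nat \<Rightarrow> code \<Rightarrow> real" where
  "error_prob \<rho> \<rho>\<^sub>f N n RU RE DT DR c =
     measure_pmf.expectation (source_pmf \<rho> \<rho>\<^sub>f N n RU RE)
       (\<lambda>(s, m). measure (noise N n) (\<Union>k\<in>active N s. wrong_at N n c DT DR s m k))"

definition achievable_rates ::
    "real \<Rightarrow> real \<Rightarrow> hex_network \<Rightarrow> real \<Rightarrow> real \<Rightarrow> real \<Rightarrow> bool" where
  "achievable_rates \<rho> \<rho>\<^sub>f N P RU Rbar \<longleftrightarrow>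
     0 \<le> RU \<and> 0 \<le> Rbar \<and>
     (\<exists>RE :: activity \<Rightarrow> nat \<Rightarrow> real.
        (\<forall>s k. 0 \<le> RE s k) \<and>
        Rbar \<le> measure_pmf.expectation (activity_pmf \<rho> \<rho>\<^sub>f N)
                  (\<lambda>s. 1 / real (ncells N) * (\<Sum>k\<in>embb N s. RE s k)) \<and>
        (\<exists>DT DR. \<exists>c :: nat \<Rightarrow> code.
           (\<forall>n\<ge>1. power_constraint \<rho> \<rho>\<^sub>f N P n RU RE DT (c n) \<and>
                  errors_measurable \<rho> \<rho>\<^sub>f N n RU RE DT DR (c n)) \<and>
           (\<lambda>n. error_prob \<rho> \<rho>\<^sub>f N n RU RE DT DR (c n)) \<longlonglongrightarrow> 0))"

definition mg :: "(nat \<Rightarrow> real \<Rightarrow> real) \<Rightarrow> ereal" where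
  "mg R = limsup (\<lambda>K. Limsup at_top (\<lambda>P. ereal (R K P / (1/2 * log 2 P))))"

definition achievable_mg :: "real \<Rightarrow> real \<Rightarrow> (nat \<Rightarrow> hex_network) \<Rightarrow> real \<Rightarrow> real \<Rightarrow> bool" where
  "achievable_mg \<rho> \<rho>\<^sub>f Net SU Se \<longleftrightarrow>
     (\<exists>RU Rbar :: nat \<Rightarrow> real \<Rightarrow> real.
        (\<forall>K\<ge>1. \<forall>P>0. achievable_rates \<rho> \<rho>\<^sub>f (Net K) P (RU K P) (Rbar K P)) \<and>
        ereal SU = ereal (\<rho> * \<rho>\<^sub>f) * mg RU \<and>
        ereal Se = mg Rbar)"

definition mg_region :: "real \<Rightarrow> real \<Rightarrow> (nat \<Rightarrow> hex_network) \<Rightarrow> (real \<times> real) set" where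
  "mg_region \<rho> \<rho>\<^sub>f Net = closure {(SU, Se). achievable_mg \<rho> \<rho>\<^sub>f Net SU Se}"

end

theory Submission imports Defs begin

text \<open>
  Every cell sends amplitude-modulated symbols from a fixed alphabet of \<open>M \<approx> sqrt P / \<kappa>\<close> levels.
  URLLC cells of one colour of a proper 3-colouring share a third of the time slots, in which no
  other URLLC cell transmits. After one cooperation round the URLLC transmitter knows the symbols of
  the neighbouring eMBB transmitters and precancels their interference at its own receiver. The eMBB
  receivers flood all outputs through their connected component and invert the channel matrix
  restricted to the cells that transmit there. Hence every stream sees a symbol-error channel whose
  errors are confined to the times at which some noise variable exceeds a threshold \<open>a\<close>. A union
  bound over sets of bad times shows that, except with probability \<open>2\<^sup>-\<^sup>n\<close>, at most
  \<open>\<delta> n\<close> times are bad; these are corrected by a Gilbert--Varshamov code of relative distance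
  \<open>2 \<delta>\<close>. The threshold depends on \<open>\<delta>\<close> and on the network but not on \<open>P\<close>, so multiplexing
  gains arbitrarily close to \<open>1/3\<close> and \<open>1\<close> per cell result, and taking the closure finishes the proof.
\<close>

subsection \<open>Inverting the channel\<close>

text \<open>Induction on \<open>S\<close>. If \<open>F a\<close> vanishes on the common kernel of
  the others, it gets coefficient 0. Otherwise some \<open>u\<close> in that kernel has
  \<open>F a u \<noteq> 0\<close>, and subtracting \<open>\<alpha> * F a\<close> from
  \<open>\<phi>\<close> reduces to \<open>S\<close>.\<close>

lemma linear_functional_in_span:
  fixes F :: "'k \<Rightarrow> ('i \<Rightarrow> real) \<Rightarrow> real" and \<phi> :: "('i \<Rightarrow> real) \<Rightarrow> real"
  assumes "finite S"
    and "\<And>k x y c. k \<in> S \<Longrightarrow> F k (\<lambda>i. x i + c * y i) = F k x + c * F k y"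
    and "\<And>x y c. \<phi> (\<lambda>i. x i + c * y i) = \<phi> x + c * \<phi> y"
    and "\<And>x. (\<And>k. k \<in> S \<Longrightarrow> F k x = 0) \<Longrightarrow> \<phi> x = 0"
  shows "\<exists>g. \<forall>x. \<phi> x = (\<Sum>k\<in>S. g k * F k x)"
  using assms
proof (induction S arbitrary: \<phi> rule: finite_induct)
  case empty
  then show ?case by simp
next
  case (insert a S)
  show ?case
  proof (cases "\<forall>x. (\<forall>k\<in>S. F k x = 0) \<longrightarrow> F a x = 0")
    case True
    have "\<exists>g. \<forall>x. \<phi> x = (\<Sum>k\<in>S. g k * F k x)"
    proof (rule insert.IH)
      fix x assume x: "\<And>k. k \<in> S \<Longrightarrow> F k x = 0"
      then have "F a x = 0" using True by blast
      then show "\<phi> x = 0" using x by (intro insert.prems(3)) auto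
    qed (use insert.prems(1,2) in auto)
    then obtain g where g: "\<And>x. \<phi> x = (\<Sum>k\<in>S. g k * F k x)" by blast
    have "\<phi> x = (\<Sum>k\<in>insert a S. (g(a := 0)) k * F k x)" for x
      using insert.hyps by (simp add: g) (rule sum.cong, auto)
    then show ?thesis by blast
  next
    case False
    then obtain u where u: "\<And>k. k \<in> S \<Longrightarrow> F k u = 0" "F a u \<noteq> 0" by blast
    define \<alpha> where "\<alpha> = \<phi> u / F a u"
    have "\<exists>g. \<forall>x. \<phi> x - \<alpha> * F a x = (\<Sum>k\<in>S. g k * F k x)"
    proof (rule insert.IH)
      fix x assume x: "\<And>k. k \<in> S \<Longrightarrow> F k x = 0"
      have "\<phi> (\<lambda>i. x i + (- (F a x / F a u)) * u i) = 0"
      proof (rule insert.prems(3))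
        fix k assume "k \<in> insert a S"
        then show "F k (\<lambda>i. x i + (- (F a x / F a u)) * u i) = 0"
          using x u insert.prems(1)[of k x "- (F a x / F a u)" u] by auto
      qed
      then show "\<phi> x - \<alpha> * F a x = 0"
        using insert.prems(2)[of x "- (F a x / F a u)" u] by (simp add: \<alpha>_def field_simps)
    next
      fix x y c
      show "\<phi> (\<lambda>i. x i + c * y i) - \<alpha> * F a (\<lambda>i. x i + c * y i) =
          \<phi> x - \<alpha> * F a x + c * (\<phi> y - \<alpha> * F a y)"
        using insert.prems(1)[of a x c y] insert.prems(2)[of x c y] by (simp add: algebra_simps)
    qed (use insert.prems(1) in auto)
    then obtain g where g: "\<And>x. \<phi> x - \<alpha> * F a x = (\<Sum>k\<in>S. g k * F k x)" by blast
    have "\<phi> x = (\<Sum>k\<in>insert a S. (g(a := \<alpha>)) k * F k x)" for x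
    proof -
      have "(\<Sum>k\<in>S. (g(a := \<alpha>)) k * F k x) = (\<Sum>k\<in>S. g k * F k x)"
        using insert.hyps by (intro sum.cong) auto
      then show ?thesis using insert.hyps g[of x] by simp
    qed
    then show ?thesis by blast
  qed
qed

lemma finite_cells [simp]: "finite (cells N)"
  by (simp add: cells_def)

text \<open>A trivial kernel on \<open>S\<close> means that coordinate \<open>i\<close> vanishes
  wherever all output functionals do, so it is a combination of them. One \<open>G\<close> covers
  all subsets, as the set to invert will vary with activity and time.\<close>

lemma nondegenerate_left_inverse:
  assumes "nondegenerate N"
  shows "\<exists>G. \<forall>S \<subseteq> cells N. \<forall>i\<in>S. \<forall>x.
    x i = (\<Sum>k\<in>S. G S i k * (\<Sum>j\<in>S. channel_matrix N j k * x j))"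
proof -
  define inv where "inv = (\<lambda>S i g. \<forall>x. x i =
    (\<Sum>k\<in>S. g k * (\<Sum>j\<in>S. channel_matrix N j k * x j)))"
  have "\<exists>g. inv S i g" if S: "S \<subseteq> cells N" and i: "i \<in> S" for S i
    unfolding inv_def
  proof (rule linear_functional_in_span)
    show "finite S" using S finite_cells finite_subset by blast
    fix x :: "nat \<Rightarrow> real"
    assume "\<And>k. k \<in> S \<Longrightarrow> (\<Sum>j\<in>S. channel_matrix N j k * x j) = 0"
    then show "x i = 0" using S i assms unfolding nondegenerate_def by blast
  qed (auto simp: algebra_simps sum.distrib sum_distrib_left)
  then have "inv S i (SOME g. inv S i g)" if "S \<subseteq> cells N" "i \<in> S" for S i
    by (rule someI_ex) (fact that)+
  then have "\<forall>S \<subseteq> cells N. \<forall>i\<in>S. inv S i (SOME g. inv S i g)" by blast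
  then have "\<exists>G. \<forall>S \<subseteq> cells N. \<forall>i\<in>S. inv S i (G S i)"
    by (rule exI[of _ "\<lambda>S i. SOME g. inv S i g"])
  then show ?thesis unfolding inv_def .
qed

subsection \<open>Codes with large minimum distance\<close>

definition hamming :: "'t set \<Rightarrow> ('t \<Rightarrow> 'a) \<Rightarrow> ('t \<Rightarrow> 'a) \<Rightarrow> nat" where
  "hamming T x y = card {t \<in> T. x t \<noteq> y t}"

lemma hamming_triangle:
  assumes "finite T"
  shows "hamming T x z \<le> hamming T x y + hamming T y z"
proof -
  have "{t \<in> T. x t \<noteq> z t} \<subseteq> {t \<in> T. x t \<noteq> y t} \<union> {t \<in> T. y t \<noteq> z t}" by auto
  then have "hamming T x z \<le> card ({t \<in> T. x t \<noteq> y t} \<union> {t \<in> T. y t \<noteq> z t})"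
    unfolding hamming_def using assms by (intro card_mono) auto
  also have "\<dots> \<le> hamming T x y + hamming T y z"
    unfolding hamming_def by (rule card_Un_le)
  finally show ?thesis .
qed

lemma hamming_commute: "hamming T x y = hamming T y x"
  unfolding hamming_def by metis

text \<open>A word of the ball agrees with \<open>c\<close> off some set \<open>A\<close> of at most
  \<open>d\<close> positions. Counting these sets by \<open>2 ^ card T\<close> instead of binomials
  costs one bit per position, a loss that does not grow with the alphabet.\<close>

lemma card_hamming_ball:
  fixes c :: "'t \<Rightarrow> nat"
  assumes "finite T" "1 \<le> M"
  shows "card {x \<in> T \<rightarrow>\<^sub>E {..<M}. hamming T c x \<le> d} \<le> 2 ^ card T * M ^ d"
proof -
  let ?B = "\<lambda>A. {x \<in> T \<rightarrow>\<^sub>E {..<M}. \<forall>t\<in>T - A. x t = c t}"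
  have fin: "finite (T \<rightarrow>\<^sub>E {..<M})" using assms by (simp add: finite_PiE)
  have cB: "card (?B A) \<le> M ^ card A" if "A \<subseteq> T" for A
  proof -
    have "finite A" using that assms finite_subset by blast
    have "inj_on (\<lambda>x. restrict x A) (?B A)"
    proof (rule inj_onI)
      fix x y assume x: "x \<in> ?B A" and y: "y \<in> ?B A" and eq: "restrict x A = restrict y A"
      show "x = y"
      proof
        fix t
        have "x t = y t" if "t \<in> A" using fun_cong[OF eq, of t] that by simp
        moreover have "x t = y t" if "t \<notin> A" "t \<in> T" using x y that by simp
        moreover have "x t = y t" if "t \<notin> T"
          using x y that PiE_arb[of x T "\<lambda>_. {..<M}" t] PiE_arb[of y T "\<lambda>_. {..<M}" t] by simp
        ultimately show "x t = y t" by blast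
      qed
    qed
    moreover have "(\<lambda>x. restrict x A) ` ?B A \<subseteq> A \<rightarrow>\<^sub>E {..<M}"
      using that by (auto simp: PiE_def Pi_def)
    ultimately have "card (?B A) \<le> card (A \<rightarrow>\<^sub>E {..<M})"
      using \<open>finite A\<close> by (intro card_inj_on_le) (auto simp: finite_PiE)
    then show ?thesis using \<open>finite A\<close> by (simp add: card_PiE)
  qed
  have "{x \<in> T \<rightarrow>\<^sub>E {..<M}. hamming T c x \<le> d} \<subseteq> (\<Union>A\<in>{A. A \<subseteq> T \<and> card A \<le> d}. ?B A)"
  proof
    fix x assume x: "x \<in> {x \<in> T \<rightarrow>\<^sub>E {..<M}. hamming T c x \<le> d}"
    then show "x \<in> (\<Union>A\<in>{A. A \<subseteq> T \<and> card A \<le> d}. ?B A)"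
      by (intro UN_I[of "{t \<in> T. c t \<noteq> x t}"]) (auto simp: hamming_def)
  qed
  then have "card {x \<in> T \<rightarrow>\<^sub>E {..<M}. hamming T c x \<le> d}
      \<le> card (\<Union>A\<in>{A. A \<subseteq> T \<and> card A \<le> d}. ?B A)"
    using assms fin by (intro card_mono) auto
  also have "\<dots> \<le> (\<Sum>A\<in>{A. A \<subseteq> T \<and> card A \<le> d}. card (?B A))"
    using assms by (intro card_UN_le) auto
  also have "\<dots> \<le> (\<Sum>A\<in>{A. A \<subseteq> T \<and> card A \<le> d}. M ^ d)"
  proof (rule sum_mono)
    fix A assume "A \<in> {A. A \<subseteq> T \<and> card A \<le> d}"
    then show "card (?B A) \<le> M ^ d"
      using cB[of A] power_increasing[of "card A" d M] assms(2) by auto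
  qed
  also have "\<dots> = card {A. A \<subseteq> T \<and> card A \<le> d} * M ^ d" by simp
  also have "\<dots> \<le> card (Pow T) * M ^ d"
    using assms by (intro mult_right_mono card_mono) auto
  finally show ?thesis using assms by (simp add: card_Pow)
qed

text \<open>In a code of greatest cardinality the balls of radius \<open>d\<close> cover all words,
  since an uncovered word could be added.\<close>

lemma gilbert_varshamov:
  assumes "finite T" "1 \<le> M"
  shows "\<exists>C \<subseteq> T \<rightarrow>\<^sub>E {..<M::nat}. (\<forall>x\<in>C. \<forall>y\<in>C. x \<noteq> y \<longrightarrow> d < hamming T x y) \<and>
           M ^ card T \<le> card C * (2 ^ card T * M ^ d)"
proof -
  let ?W = "T \<rightarrow>\<^sub>E {..<M}"
  let ?good = "\<lambda>C. C \<subseteq> ?W \<and> (\<forall>x\<in>C. \<forall>y\<in>C. x \<noteq> y \<longrightarrow> d < hamming T x y)"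
  have fin: "finite ?W" using assms by (simp add: finite_PiE)
  have "\<forall>C. ?good C \<longrightarrow> card C \<le> card ?W" using fin by (auto intro: card_mono)
  moreover have "?good {}" by simp
  ultimately have "\<exists>C. ?good C \<and> (\<forall>D. ?good D \<longrightarrow> card D \<le> card C)"
    by (intro ex_has_greatest_nat[where k = "{}" and b = "Suc (card ?W)"]) (simp_all add: less_Suc_eq_le)
  then obtain C where C: "?good C" and max: "\<And>D. ?good D \<Longrightarrow> card D \<le> card C"
    by (elim exE conjE) blast
  note CW = conjunct1[OF C] and Cd = conjunct2[OF C]
  have finC: "finite C" using CW fin finite_subset by blast
  have "?W \<subseteq> (\<Union>c\<in>C. {x \<in> ?W. hamming T c x \<le> d})"
  proof
    fix x assume x: "x \<in> ?W"
    show "x \<in> (\<Union>c\<in>C. {x \<in> ?W. hamming T c x \<le> d})"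
    proof (rule ccontr)
      assume "\<not> ?thesis"
      then have far: "\<And>c. c \<in> C \<Longrightarrow> d < hamming T c x" using x by force
      have "x \<notin> C" using far[of x] by (auto simp: hamming_def)
      moreover have "insert x C \<subseteq> ?W" using CW x by simp
      then have "?good (insert x C)"
        using Cd far hamming_commute[of T x] by (metis insert_iff)
      then have "card (insert x C) \<le> card C" by (rule max)
      ultimately show False using finC by simp
    qed
  qed
  then have "card ?W \<le> card (\<Union>c\<in>C. {x \<in> ?W. hamming T c x \<le> d})"
    using fin finC by (intro card_mono) auto
  also have "\<dots> \<le> (\<Sum>c\<in>C. card {x \<in> ?W. hamming T c x \<le> d})"
    by (rule card_UN_le[OF finC])
  also have "\<dots> \<le> (\<Sum>c\<in>C. 2 ^ card T * M ^ d)"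
    by (intro sum_mono card_hamming_ball assms)
  finally have "M ^ card T \<le> card C * (2 ^ card T * M ^ d)"
    using assms by (simp add: card_PiE)
  then show ?thesis by (intro exI[of _ C] conjI CW Cd)
qed

text \<open>Makes the code a total book: surplus messages and positions outside \<open>T\<close>
  carry symbol 0, which is below \<open>M\<close>. The book is fixed before \<open>L\<close>, so one
  book per slot set serves every message count that fits.\<close>

lemma codebook_exists:
  assumes "finite T" "1 \<le> M"
  shows "\<exists>b :: nat \<Rightarrow> 't \<Rightarrow> nat. (\<forall>m t. b m t < M) \<and>
    (\<forall>L. L * (2 ^ card T * M ^ d) \<le> M ^ card T \<longrightarrow>
      (\<forall>m\<in>{1..L}. \<forall>m'\<in>{1..L}. m \<noteq> m' \<longrightarrow> d < hamming T (b m) (b m')))"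
proof -
  obtain C where C: "C \<subseteq> T \<rightarrow>\<^sub>E {..<M}"
    and dist: "\<And>x y. x \<in> C \<Longrightarrow> y \<in> C \<Longrightarrow> x \<noteq> y \<Longrightarrow> d < hamming T x y"
    and card: "M ^ card T \<le> card C * (2 ^ card T * M ^ d)"
    using gilbert_varshamov[OF assms, of d] by (elim exE conjE) simp
  have "finite C" by (rule finite_subset[OF C]) (simp add: assms finite_PiE)
  then obtain h where h: "bij_betw h {1..card C} C" using ex_bij_betw_nat_finite_1 by blast
  define b where "b = (\<lambda>m t. if m \<in> {1..card C} \<and> t \<in> T then h m t else 0)"
  have hC: "h m \<in> C" if "m \<in> {1..card C}" for m using h that by (auto simp: bij_betw_def)
  have "b m t < M" for m t
    using hC[of m] C assms(2) by (auto simp: b_def PiE_def Pi_def)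
  moreover have "d < hamming T (b m) (b m')"
    if L: "L * (2 ^ card T * M ^ d) \<le> M ^ card T" and m: "m \<in> {1..L}" "m' \<in> {1..L}" "m \<noteq> m'" for L m m'
  proof -
    have "L * (2 ^ card T * M ^ d) \<le> card C * (2 ^ card T * M ^ d)" using L card by linarith
    then have "L \<le> card C" using assms(2) by simp
    then have mm: "m \<in> {1..card C}" "m' \<in> {1..card C}" using m by auto
    then have "h m \<noteq> h m'" using inj_onD[OF bij_betw_imp_inj_on[OF h]] m(3) by blast
    then have "d < hamming T (h m) (h m')" using dist hC mm by blast
    also have "hamming T (h m) (h m') = hamming T (b m) (b m')"
      unfolding hamming_def using mm by (intro arg_cong[where f=card]) (auto simp: b_def)
    finally show ?thesis .
  qed
  ultimately show ?thesis by blast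
qed

subsection \<open>Flooding\<close>

text \<open>Terminals relay tables of values indexed by cells, in which \<open>d\<close> means
  unknown. The choice by \<open>SOME\<close> is harmless as long as all known entries for
  \<open>l\<close> agree.\<close>

definition flood :: "'b \<Rightarrow> nat \<Rightarrow> 'b \<Rightarrow> (nat \<Rightarrow> 'b) history \<Rightarrow> nat \<Rightarrow> 'b" where
  "flood d j y h l =
     (if l = j then y
      else if \<exists>g\<in>set h. \<exists>i v. g i = Some v \<and> v l \<noteq> d
      then (SOME b. b \<noteq> d \<and> (\<exists>g\<in>set h. \<exists>i v. g i = Some v \<and> v l = b))
      else d)"

text \<open>Entries other than \<open>d\<close> all equal \<open>val l\<close>, so the choice is
  forced. If \<open>val l\<close> happens to be \<open>d\<close>, the default is already
  right.\<close>

lemma flood_correct: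
  assumes known: "\<And>g i v. g \<in> set h \<Longrightarrow> g i = Some v \<Longrightarrow> v l \<in> {d, val l}"
  shows "flood d j (val j) h l \<in> {d, val l}"
    and "g \<in> set h \<Longrightarrow> g i = Some v \<Longrightarrow> v l = val l \<Longrightarrow> flood d j (val j) h l = val l"
proof -
  have *: "(SOME b. b \<noteq> d \<and> (\<exists>g\<in>set h. \<exists>i v. g i = Some v \<and> v l = b)) = val l"
    if "\<exists>g\<in>set h. \<exists>i v. g i = Some v \<and> v l \<noteq> d"
    by (rule some_equality) (use that known in \<open>auto; metis insertE singletonD\<close>)+
  then show "flood d j (val j) h l \<in> {d, val l}" by (auto simp: flood_def)
  show "flood d j (val j) h l = val l" if "g \<in> set h" "g i = Some v" "v l = val l"
    using * that by (auto simp: flood_def)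
qed

text \<open>A value travels one link per round and is never lost again.\<close>

lemma flood_reaches:
  fixes val :: "nat \<Rightarrow> 'b" and d :: 'b
  defines "f \<equiv> \<lambda>j (i::nat). flood d j (val j)"
  assumes R: "\<And>k j. (k, j) \<in> R \<Longrightarrow> j \<in> nb k"
    and "(k, l) \<in> R ^^ q" "q \<le> r"
  shows "flood d k (val k) (received nb f r k) l = val l"
proof -
  \<comment> \<open>Invariant: no table ever holds a wrong value, so later messages cannot spoil
    what is known.\<close>
  have known: "v l \<in> {d, val l}" if "g \<in> set (received nb f r k)" "g i = Some v" for g i v r k
    using that
  proof (induction r arbitrary: k g i v)
    case 0
    then show ?case by simp
  next
    case (Suc r)
    show ?case
    proof (cases "g \<in> set (received nb f r k)")
      case True
      then show ?thesis using Suc by blast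
    next
      case False
      then have "v = flood d i (val i) (received nb f r i)"
        using Suc.prems by (auto simp: f_def split: if_splits)
      moreover have "flood d i (val i) (received nb f r i) l \<in> {d, val l}"
        by (rule flood_correct(1)) (use Suc.IH in blast)
      ultimately show ?thesis by simp
    qed
  qed
  show ?thesis using assms(3,4)
  proof (induction r arbitrary: k q)
    case 0
    then show ?case by (simp add: flood_def)
  next
    case (Suc r)
    show ?case
    proof (cases q)
      case 0
      then show ?thesis using Suc.prems by (simp add: flood_def)
    next
      case (Suc q')
      then obtain i where i: "(k, i) \<in> R" "(i, l) \<in> R ^^ q'"
        using Suc.prems(1) relpow_Suc_E2[of k l q' R] by blast
      have IH: "flood d i (val i) (received nb f r i) l = val l"
        using Suc.IH[OF i(2)] Suc.prems(2) \<open>q = Suc q'\<close> by simp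
      let ?g = "\<lambda>j. if j \<in> nb k then Some (f j k (received nb f r j)) else None"
      show ?thesis
      proof (rule flood_correct(2))
        show "?g \<in> set (received nb f (Suc r) k)" by simp
        show "?g i = Some (flood d i (val i) (received nb f r i))"
          using R[OF i(1)] by (simp add: f_def)
      qed (use known IH in blast)+
    qed
  qed
qed

subsection \<open>Noise\<close>

abbreviation std_normal :: "real measure" where
  "std_normal \<equiv> density lborel std_normal_density"

lemma prob_space_noise: "prob_space (noise N n)"
  unfolding noise_def by (intro prob_space_PiM prob_space_normal_density) simp

lemma std_normal_tail: "(\<lambda>i. measure std_normal {x. real i \<le> \<bar>x\<bar>}) \<longlonglongrightarrow> 0"
proof -
  interpret prob_space std_normal by (intro prob_space_normal_density) simp
  have "(\<lambda>i. measure std_normal {x. real i \<le> \<bar>x\<bar>}) \<longlonglongrightarrow> measure std_normal (\<Inter>i. {x. real i \<le> \<bar>x\<bar>})"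
    by (rule finite_Lim_measure_decseq) (auto simp: decseq_def)
  also have "(\<Inter>i. {x::real. real i \<le> \<bar>x\<bar>}) = {}"
    by auto (metis abs_ge_zero not_less reals_Archimedean2)
  finally show ?thesis by simp
qed

definition bad_times :: "hex_network \<Rightarrow> nat \<Rightarrow> real \<Rightarrow> (nat \<times> nat \<Rightarrow> real) \<Rightarrow> nat set" where
  "bad_times N n a z = {t \<in> {1..n}. \<exists>j\<in>cells N. a \<le> \<bar>z (j, t)\<bar>}"

text \<open>One noise variable is constrained per time of \<open>A\<close>. Distinct times give
  distinct coordinates of the product measure, so \<open>E\<close> is a box and its probability
  factorizes.\<close>

lemma noise_box:
  fixes a :: real
  assumes "A \<subseteq> {1..n}" "\<phi> \<in> A \<rightarrow> cells N"
  defines "E \<equiv> {z \<in> space (noise N n). \<forall>t\<in>A. a \<le> \<bar>z (\<phi> t, t)\<bar>}"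
  shows "E \<in> sets (noise N n)"
    and "measure (noise N n) E = measure std_normal {x. a \<le> \<bar>x\<bar>} ^ card A"
proof -
  let ?I = "cells N \<times> {1..n}" and ?J = "(\<lambda>t. (\<phi> t, t)) ` A"
  let ?B = "{x::real. a \<le> \<bar>x\<bar>}"
  let ?S = "\<lambda>p. if p \<in> ?J then ?B else UNIV"
  interpret std: prob_space std_normal by (intro prob_space_normal_density) simp
  interpret product_prob_space "\<lambda>_. std_normal" ?I by unfold_locales
  interpret finite_product_prob_space "\<lambda>_. std_normal" ?I by unfold_locales simp
  have J: "?J \<subseteq> ?I" using assms by auto
  have E: "E = (\<Pi>\<^sub>E p\<in>?I. ?S p)"
    using J by (auto simp: E_def noise_def space_PiM PiE_def Pi_def extensional_def split: if_splits)
  have [measurable]: "?B \<in> sets borel" by measurable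
  show "E \<in> sets (noise N n)"
    unfolding E noise_def by (intro sets_PiM_I_finite) auto
  have "measure (noise N n) E = (\<Prod>p\<in>?I. measure std_normal (?S p))"
    unfolding E noise_def by (intro finite_measure_PiM_emb) auto
  also have "\<dots> = (\<Prod>p\<in>?J. measure std_normal ?B)"
    using J std.prob_space by (intro prod.mono_neutral_cong_right) auto
  also have "\<dots> = measure std_normal ?B ^ card ?J" by simp
  also have "card ?J = card A" by (intro card_image inj_onI) auto
  finally show "measure (noise N n) E = measure std_normal {x. a \<le> \<bar>x\<bar>} ^ card A" .
qed

text \<open>Union bound: more than \<open>e\<close> bad times include a set \<open>A\<close> of
  \<open>Suc e\<close>, each with a culprit cell. There are at most \<open>2 ^ n\<close> sets and
  \<open>ncells N ^ Suc e\<close> culprit maps per set; each box has probability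
  \<open>q ^ Suc e\<close>.\<close>

lemma many_bad_times:
  fixes a :: real
  defines "q \<equiv> measure std_normal {x. a \<le> \<bar>x\<bar>}"
  shows "\<exists>E \<in> sets (noise N n). {z \<in> space (noise N n). e < card (bad_times N n a z)} \<subseteq> E \<and>
     measure (noise N n) E \<le> 2 ^ n * (real (ncells N) * q) ^ Suc e"
proof -
  interpret prob_space "noise N n" by (rule prob_space_noise)
  let ?As = "{A. A \<subseteq> {1..n} \<and> card A = Suc e}"
  let ?X = "SIGMA A:?As. A \<rightarrow>\<^sub>E cells N"
  let ?E = "\<lambda>(A, \<phi>). {z \<in> space (noise N n). \<forall>t\<in>A. a \<le> \<bar>z (\<phi> t, t)\<bar>}"
  have fA: "finite ?As" by simp
  have fX: "finite ?X"
    by (intro finite_SigmaI fA finite_PiE) (auto intro: finite_subset)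
  have sets: "?E x \<in> sets (noise N n)" if "x \<in> ?X" for x
    using that by (cases x) (simp add: noise_box(1) PiE_iff Pi_iff)
  have "{z \<in> space (noise N n). e < card (bad_times N n a z)} \<subseteq> (\<Union>x\<in>?X. ?E x)"
  proof
    fix z assume z: "z \<in> {z \<in> space (noise N n). e < card (bad_times N n a z)}"
    then have "Suc e \<le> card (bad_times N n a z)" by simp
    then obtain A where A: "A \<subseteq> bad_times N n a z" "card A = Suc e"
      by (rule obtain_subset_with_card_n)
    then have "\<forall>t\<in>A. \<exists>j. j \<in> cells N \<and> a \<le> \<bar>z (j, t)\<bar>" by (auto simp: bad_times_def)
    then obtain \<phi> where \<phi>: "\<forall>t\<in>A. \<phi> t \<in> cells N \<and> a \<le> \<bar>z (\<phi> t, t)\<bar>" by metis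
    then have "z \<in> ?E (A, restrict \<phi> A)" using z by simp
    moreover have "(A, restrict \<phi> A) \<in> ?X" using A \<phi> by (auto simp: bad_times_def)
    ultimately show "z \<in> (\<Union>x\<in>?X. ?E x)" by (rule UN_I[rotated])
  qed
  moreover have "(\<Union>x\<in>?X. ?E x) \<in> sets (noise N n)" using fX sets by (intro sets.finite_UN) auto
  moreover have "measure (noise N n) (\<Union>x\<in>?X. ?E x) \<le> 2 ^ n * (real (ncells N) * q) ^ Suc e"
  proof -
    have "measure (noise N n) (\<Union>x\<in>?X. ?E x) \<le> (\<Sum>x\<in>?X. measure (noise N n) (?E x))"
      using fX sets by (intro measure_UNION_le) auto
    also have "\<dots> = (\<Sum>x\<in>?X. q ^ Suc e)"
      using noise_box(2) by (intro sum.cong) (auto simp: q_def PiE_def)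
    also have "\<dots> = real (card ?X) * q ^ Suc e" by simp
    also have "card ?X = (\<Sum>A\<in>?As. ncells N ^ Suc e)"
    proof -
      have "card ?X = (\<Sum>A\<in>?As. card (A \<rightarrow>\<^sub>E cells N))"
        by (intro card_SigmaI) (auto intro!: finite_PiE intro: finite_subset)
      also have "\<dots> = (\<Sum>A\<in>?As. ncells N ^ Suc e)"
        by (intro sum.cong refl) (auto simp: card_PiE cells_def finite_subset)
      finally show ?thesis .
    qed
    also have "real (\<Sum>A\<in>?As. ncells N ^ Suc e) * q ^ Suc e
        = real (card ?As) * (real (ncells N) * q) ^ Suc e"
      by (simp add: power_mult_distrib)
    also have "card ?As \<le> card (Pow {1..n})" by (intro card_mono) auto
    then have "real (card ?As) \<le> 2 ^ n" by (simp add: card_Pow)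
    then have "real (card ?As) * (real (ncells N) * q) ^ Suc e \<le> 2 ^ n * (real (ncells N) * q) ^ Suc e"
      by (intro mult_right_mono) (auto simp: q_def)
    finally show ?thesis .
  qed
  ultimately show ?thesis by blast
qed

subsection \<open>The transmission scheme\<close>

lemma finite_neighbours [simp]: "finite (neighbours N k)"
  unfolding neighbours_def by simp

lemma neighbours_subset: "neighbours N k \<subseteq> cells N"
  by (auto simp: neighbours_def)

lemma neighbours_irrefl: "k \<notin> neighbours N k"
  by (auto simp: neighbours_def)

text \<open>All six neighbour offsets change \<open>x + y\<close> by \<open>\<plusminus>1\<close> or \<open>\<plusminus>2\<close>, so this is a proper 3-colouring.\<close>

definition colour :: "hex_network \<Rightarrow> nat \<Rightarrow> nat" where
  "colour N k = nat ((xcoord N k + ycoord N k) mod 3)"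

lemma colour_less: "colour N k < 3"
  by (simp add: colour_def)

lemma neighbours_colour:
  assumes "j \<in> neighbours N k"
  shows "colour N j \<noteq> colour N k"
proof
  define u where "u = xcoord N k + ycoord N k"
  define v where "v = xcoord N j + ycoord N j"
  have "u - v \<in> {1, -1, 2, -2}" using assms by (auto simp: neighbours_def u_def v_def)
  moreover assume "colour N j = colour N k"
  then have "u mod 3 = v mod 3" by (simp add: colour_def u_def v_def nat_eq_iff)
  then have "3 dvd u - v" by (simp add: mod_eq_dvd_iff)
  ultimately show False by auto
qed

definition slots :: "hex_network \<Rightarrow> activity \<Rightarrow> nat \<Rightarrow> nat \<Rightarrow> nat set" where
  "slots N s n k = {t \<in> {1..n}. k \<in> urllc N s \<longrightarrow> t mod 3 = colour N k}"

lemma finite_slots [simp]: "finite (slots N s n k)"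
  by (simp add: slots_def)

lemma card_slots_urllc: "real n / 3 - 1 \<le> real (card (slots N s n k))"
proof -
  \<comment> \<open>Times start at 1, so the slots of colour 0 are 3, 6, ... and not 0, 3, ...; each
    full block of three times holds one slot.\<close>
  have "(\<lambda>i. 3 * i + (if colour N k = 0 then 3 else colour N k)) ` {..<n div 3} \<subseteq> slots N s n k"
    using colour_less[of N k] by (auto simp: slots_def)
  then have "card ((\<lambda>i. 3 * i + (if colour N k = 0 then 3 else colour N k)) ` {..<n div 3})
      \<le> card (slots N s n k)"
    by (intro card_mono) auto
  moreover have "inj (\<lambda>i. 3 * i + (if colour N k = 0 then 3 else colour N k))"
    by (auto intro: injI)
  ultimately have "n div 3 \<le> card (slots N s n k)"
    by (simp add: card_image inj_on_subset)
  moreover have "real n / 3 - 1 \<le> real (n div 3)" by linarith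
  ultimately show ?thesis by linarith
qed

lemma card_slots_embb: "k \<notin> urllc N s \<Longrightarrow> card (slots N s n k) = n"
  unfolding slots_def by (simp del: atLeastAtMost_iff)

section \<open>Connected components of the active cells\<close>

definition active_links :: "hex_network \<Rightarrow> activity \<Rightarrow> (nat \<times> nat) set" where
  "active_links N s = {(k, j). k \<in> active N s \<and> j \<in> active_neighbours N s k}"

definition component :: "hex_network \<Rightarrow> activity \<Rightarrow> nat \<Rightarrow> nat set" where
  "component N s k = (active_links N s)\<^sup>* `` {k}"

lemma active_subset: "active N s \<subseteq> cells N"
  by (auto simp: active_def)

lemma component_active: "k \<in> active N s \<Longrightarrow> component N s k \<subseteq> active N s"
proof
  fix l assume k: "k \<in> active N s" and "l \<in> component N s k"
  then have "(k, l) \<in> (active_links N s)\<^sup>*" by (simp add: component_def)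
  then show "l \<in> active N s"
    by (induction rule: rtrancl_induct) (use k in \<open>auto simp: active_links_def active_neighbours_def\<close>)
qed

lemma component_step:
  assumes "k \<in> active N s" "l \<in> component N s k" "j \<in> neighbours N l" "j \<in> active N s"
  shows "j \<in> component N s k"
proof -
  have "(l, j) \<in> active_links N s"
    using assms component_active by (auto simp: active_links_def active_neighbours_def)
  then show ?thesis using assms(2) by (auto simp: component_def)
qed

text \<open>A reachable cell is reached along at most as many links as
  \<open>active_links N s\<close> contains, hence within \<open>ncells N * ncells N\<close> rounds.
  This number depends on neither the activity nor the blocklength.\<close>

lemma flood_component:
  assumes "l \<in> component N s k"
  shows "flood d k (val k) (received (active_neighbours N s) (\<lambda>j i. flood d j (val j))
           (ncells N * ncells N) k) l = val l"
proof -
  have sub: "active_links N s \<subseteq> cells N \<times> cells N"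
    by (auto simp: active_links_def active_def active_neighbours_def)
  then have fin: "finite (active_links N s)" by (rule finite_subset) simp
  have "card (active_links N s) \<le> card (cells N \<times> cells N)" by (rule card_mono[OF _ sub]) simp
  then have card: "card (active_links N s) \<le> ncells N * ncells N"
    by (simp add: card_cartesian_product cells_def)
  obtain q where "(k, l) \<in> active_links N s ^^ q" "q \<le> card (active_links N s)"
    using assms rtrancl_finite_eq_relpow[OF fin] by (auto simp: component_def)
  then show ?thesis
    using card by (intro flood_reaches[where R = "active_links N s" and q = q])
      (auto simp: active_links_def)
qed

text \<open>The book \<open>b T\<close> lives on the time slots in \<open>T\<close>; \<open>G S i k\<close> are the entries of an inverse
  of the channel matrix restricted to \<open>S\<close>, and a symbol \<open>x\<close> is sent as the amplitude \<open>\<Delta> x\<close>.\<close>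

record pam_params =
  spacing :: real
  book :: "nat set \<Rightarrow> nat \<Rightarrow> nat \<Rightarrow> nat"
  invmat :: "nat set \<Rightarrow> nat \<Rightarrow> nat \<Rightarrow> real"
  nmsg :: "activity \<Rightarrow> nat \<Rightarrow> nat"
  radius :: nat

definition codeword ::
    "hex_network \<Rightarrow> nat \<Rightarrow> pam_params \<Rightarrow> activity \<Rightarrow> nat \<Rightarrow> nat \<Rightarrow> nat \<Rightarrow> real" where
  "codeword N n p s k m t =
     (if t \<in> slots N s n k then spacing p * real (book p (slots N s n k) m t) else 0)"

text \<open>The division by the own gain makes the subtracted sum cancel the eMBB interference at
  the own receiver. One round suffices because eMBB transmitters do not precancel: their inputs
  follow from their messages alone. \<open>hd h\<close> is that round; a Tx message is a constant
  function, read at 0.\<close>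

definition pam_encode ::
    "hex_network \<Rightarrow> nat \<Rightarrow> pam_params \<Rightarrow> activity \<Rightarrow> nat \<Rightarrow> nat \<Rightarrow> tx_msg history \<Rightarrow> nat \<Rightarrow> real" where
  "pam_encode N n p s k m h t = codeword N n p s k m t -
     (if k \<in> urllc N s \<and> t \<in> slots N s n k
      then \<Sum>j\<in>neighbours N k \<inter> embb N s. gain N j k / gain N k k * codeword N n p s j (the (hd h j) 0) t
      else 0)"

text \<open>A URLLC receiver uses its own output only, its interference having been cancelled at the
  transmitter, so it inverts a 1-by-1 channel.\<close>

definition inverted_cells :: "hex_network \<Rightarrow> nat \<Rightarrow> activity \<Rightarrow> nat \<Rightarrow> nat \<Rightarrow> nat set" where
  "inverted_cells N n s k t =
     (if k \<in> urllc N s then {k} else {l \<in> component N s k. t \<in> slots N s n l})"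

definition estimate ::
    "hex_network \<Rightarrow> nat \<Rightarrow> pam_params \<Rightarrow> activity \<Rightarrow> nat \<Rightarrow> (nat \<Rightarrow> nat \<Rightarrow> real) \<Rightarrow> nat \<Rightarrow> int" where
  "estimate N n p s k y t =
     round ((\<Sum>l\<in>inverted_cells N n s k t. invmat p (inverted_cells N n s k t) k l * y l t) / spacing p)"

text \<open>Bounded-distance decoding: minimum distance above \<open>2 * radius p\<close> leaves at
  most one candidate. The word is integer-valued because rounding at a bad time may leave the
  alphabet.\<close>

definition nearest ::
    "hex_network \<Rightarrow> nat \<Rightarrow> pam_params \<Rightarrow> activity \<Rightarrow> nat \<Rightarrow> (nat \<Rightarrow> int) \<Rightarrow> nat" where
  "nearest N n p s k v = (SOME m. m \<in> {1..nmsg p s k} \<and>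
     hamming (slots N s n k) v (\<lambda>t. int (book p (slots N s n k) m t)) \<le> radius p)"

definition pam_decode ::
    "hex_network \<Rightarrow> nat \<Rightarrow> pam_params \<Rightarrow> activity \<Rightarrow> nat \<Rightarrow> (nat \<Rightarrow> nat \<Rightarrow> real) \<Rightarrow> nat" where
  "pam_decode N n p s k y = nearest N n p s k (restrict (estimate N n p s k y) {1..n})"

text \<open>A URLLC decoder presents its own block as that of every cell, but only the entry of the
  cell itself is read. Flooding marks unknown outputs by the zero block.\<close>

definition pam_code :: "hex_network \<Rightarrow> nat \<Rightarrow> pam_params \<Rightarrow> code" where
  "pam_code N n p = \<lparr>
     tx_coop = \<lambda>s j i mo h _. (case mo of None \<Rightarrow> 0 | Some m \<Rightarrow> m),
     encode = pam_encode N n p,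
     urllc_decode = \<lambda>s k y. pam_decode N n p s k (\<lambda>_. y),
     rx_coop = \<lambda>s j i y h. flood (\<lambda>_. 0) j y h,
     embb_decode = \<lambda>s k y h. pam_decode N n p s k (flood (\<lambda>_. 0) k y h)\<rparr>"

lemma pam_input:
  "channel_input N (pam_code N n p) (Suc 0) s m k t =
     (if k \<in> active N s then codeword N n p s k (m k) t -
       (if k \<in> urllc N s \<and> t \<in> slots N s n k
        then \<Sum>j\<in>neighbours N k \<inter> embb N s. gain N j k / gain N k k * codeword N n p s j (m j) t
        else 0) else 0)"
  by (auto simp: channel_input_def pam_code_def pam_encode_def active_neighbours_def embb_def
      intro!: sum.cong)

text \<open>An eMBB estimate reads only outputs of its component, where flooding delivers the true
  ones; a URLLC estimate reads only its own.\<close>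

lemma pam_decision:
  assumes "k \<in> active N s"
  shows "decision N (pam_code N n p) (ncells N * ncells N) s y k = pam_decode N n p s k y"
proof (cases "k \<in> urllc N s")
  case True
  then have "estimate N n p s k (\<lambda>_. y k) = estimate N n p s k y"
    by (simp add: estimate_def inverted_cells_def fun_eq_iff)
  with True show ?thesis by (simp add: decision_def pam_code_def pam_decode_def)
next
  case False
  let ?h = "received (active_neighbours N s) (\<lambda>j i. flood (\<lambda>_. 0) j (y j)) (ncells N * ncells N) k"
  have "flood (\<lambda>_. 0) k (y k) ?h l = y l" if "l \<in> component N s k" for l
    using that by (rule flood_component)
  then have "estimate N n p s k (flood (\<lambda>_. 0) k (y k) ?h) = estimate N n p s k y"
    using False unfolding estimate_def inverted_cells_def
    by (intro ext arg_cong[where f = round] arg_cong[where f = "\<lambda>x. x / spacing p"] sum.cong) auto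
  then show ?thesis
    using False by (simp add: decision_def pam_code_def pam_decode_def)
qed

text \<open>The decision depends on the noise only through a block of \<open>n\<close> integers.
  There are countably many blocks, so the error event is a countable union of events, however
  irregular \<open>nearest\<close> is.\<close>

lemma measurable_pam_error:
  "{z \<in> space (noise N n). pam_decode N n p s k (channel_output N n X z) \<noteq> m} \<in> sets (noise N n)"
    (is "?E \<in> _") if k: "k \<in> active N s"
proof -
  let ?e = "\<lambda>z. estimate N n p s k (channel_output N n X z)"
  let ?V = "{v \<in> {1..n} \<rightarrow>\<^sub>E (UNIV :: int set). nearest N n p s k v \<noteq> m}"
  have "countable ({1..n} \<rightarrow>\<^sub>E (UNIV :: int set))" by (intro countable_PiE) auto
  then have V: "countable ?V" by (rule countable_subset[rotated]) auto
  have meas: "(\<lambda>z. ?e z t) \<in> measurable (noise N n) (count_space UNIV)" if t: "t \<in> {1..n}" for t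
  proof -
    have sub: "inverted_cells N n s k t \<subseteq> cells N"
      using k component_active[OF k] active_subset by (auto simp: inverted_cells_def)
    have "(\<lambda>z. channel_output N n X z l t) \<in> borel_measurable (noise N n)"
      if "l \<in> inverted_cells N n s k t" for l
    proof -
      have "(\<lambda>z. z (l, t)) \<in> measurable (noise N n) std_normal"
        unfolding noise_def by (rule measurable_component_singleton) (use that sub t in auto)
      then have [measurable]: "(\<lambda>z. z (l, t)) \<in> borel_measurable (noise N n)" by simp
      show ?thesis using t by (simp add: channel_output_def)
    qed
    note [measurable] = this
    show ?thesis unfolding estimate_def round_def by measurable
  qed
  have "?E = (\<Union>v\<in>?V. {z \<in> space (noise N n). \<forall>t\<in>{1..n}. ?e z t = v t})"
  proof (intro equalityI subsetI)
    fix z assume "z \<in> ?E"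
    then show "z \<in> (\<Union>v\<in>?V. {z \<in> space (noise N n). \<forall>t\<in>{1..n}. ?e z t = v t})"
      by (intro UN_I[of "restrict (?e z) {1..n}"]) (auto simp: pam_decode_def)
  next
    fix z assume "z \<in> (\<Union>v\<in>?V. {z \<in> space (noise N n). \<forall>t\<in>{1..n}. ?e z t = v t})"
    then obtain v where v: "v \<in> {1..n} \<rightarrow>\<^sub>E UNIV" "nearest N n p s k v \<noteq> m" and z: "z \<in> space (noise N n)"
      and e: "\<And>t. t \<in> {1..n} \<Longrightarrow> ?e z t = v t" by auto
    have "restrict (?e z) {1..n} = restrict v {1..n}" using e by (intro restrict_ext) auto
    also have "\<dots> = v" using v by (intro extensional_restrict) (simp add: PiE_def)
    finally show "z \<in> ?E" using v z by (simp add: pam_decode_def)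
  qed
  moreover have "{z \<in> space (noise N n). \<forall>t\<in>{1..n}. ?e z t = v t} \<in> sets (noise N n)" for v
  proof (rule sets.sets_Collect_finite_All)
    fix t assume t: "t \<in> {1..n}"
    have "(\<lambda>z. ?e z t) -` {v t} \<inter> space (noise N n) \<in> sets (noise N n)"
      by (rule measurable_sets[OF meas[OF t]]) simp
    moreover have "(\<lambda>z. ?e z t) -` {v t} \<inter> space (noise N n) = {z \<in> space (noise N n). ?e z t = v t}"
      by auto
    ultimately show "{z \<in> space (noise N n). ?e z t = v t} \<in> sets (noise N n)" by simp
  qed auto
  ultimately show ?thesis using V by (simp only:) (intro sets.countable_UN'; auto)
qed

subsection \<open>Correctness of the scheme\<close>

lemma channel_output_restricted:
  assumes "t \<in> {1..n}" "S \<subseteq> cells N" "l \<in> S"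
    and "\<And>j. j \<in> neighbours N l \<Longrightarrow> j \<notin> S \<Longrightarrow> X j t = 0"
  shows "channel_output N n X z l t = (\<Sum>j\<in>S. channel_matrix N j l * X j t) + z (l, t)"
proof -
  have fin: "finite S" using assms(2) finite_cells finite_subset by blast
  have "(\<Sum>j\<in>S. channel_matrix N j l * X j t)
      = gain N l l * X l t + (\<Sum>j\<in>S - {l}. channel_matrix N j l * X j t)"
    using assms(3) by (simp add: sum.remove[OF fin] channel_matrix_def)
  also have "(\<Sum>j\<in>S - {l}. channel_matrix N j l * X j t) = (\<Sum>j\<in>neighbours N l. gain N j l * X j t)"
  proof (rule sum.mono_neutral_cong)
    show "\<And>i. i \<in> S - {l} - neighbours N l \<Longrightarrow> channel_matrix N i l * X i t = 0"
      by (auto simp: channel_matrix_def)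
    show "\<And>i. i \<in> neighbours N l - (S - {l}) \<Longrightarrow> gain N i l * X i t = 0"
      using assms(4) neighbours_irrefl[of l N] by auto
    show "\<And>x. x \<in> (S - {l}) \<inter> neighbours N l \<Longrightarrow> channel_matrix N x l * X x t = gain N x l * X x t"
      by (auto simp: channel_matrix_def)
  qed (use fin in auto)
  finally show ?thesis using assms(1) by (simp add: channel_output_def)
qed

text \<open>The conditions concern all \<open>S\<close>, as the inverted set varies.
  \<open>noise_margin\<close> keeps noise of size at most \<open>a\<close>, amplified by any row of
  an inverse, below half the symbol spacing.\<close>

locale pam_scheme =
  fixes N :: hex_network and p :: pam_params and a :: real
  assumes left_inverse: "\<And>S i x. S \<subseteq> cells N \<Longrightarrow> i \<in> S \<Longrightarrow>
      x i = (\<Sum>k\<in>S. invmat p S i k * (\<Sum>j\<in>S. channel_matrix N j k * x j))"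
    and spacing_pos: "0 < spacing p"
    and noise_margin: "\<And>S i. S \<subseteq> cells N \<Longrightarrow> i \<in> S \<Longrightarrow>
      (\<Sum>k\<in>S. \<bar>invmat p S i k\<bar>) * a < spacing p / 2"
begin

lemma direct_gain_nonzero: "k \<in> cells N \<Longrightarrow> gain N k k \<noteq> 0"
  using left_inverse[of "{k}" k "\<lambda>_. 1"] by (auto simp: channel_matrix_def)

lemma inverted_cells_subset:
  assumes "k \<in> active N s" shows "inverted_cells N n s k t \<subseteq> cells N"
  using assms component_active[OF assms] active_subset by (auto simp: inverted_cells_def)

text \<open>Gives both kinds of receiver the same form. For a URLLC cell \<open>x\<close> is the
  clean codeword, the interference having been cancelled; for an eMBB cell it is the actual input,
  whose URLLC entries are precancelled signals. Only entry \<open>k\<close> has to be a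
  codeword.\<close>

lemma channel_output_inverted:
  fixes s m and n :: nat defines "X \<equiv> channel_input N (pam_code N n p) (Suc 0) s m"
  assumes k: "k \<in> active N s" and t: "t \<in> slots N s n k"
  shows "k \<in> inverted_cells N n s k t"
    and "\<exists>x. x k = codeword N n p s k (m k) t \<and>
      (\<forall>l\<in>inverted_cells N n s k t. channel_output N n X z l t =
         (\<Sum>j\<in>inverted_cells N n s k t. channel_matrix N j l * x j) + z (l, t))"
proof -
  let ?S = "inverted_cells N n s k t" and ?w = "\<lambda>j. codeword N n p s j (m j) t"
  have tn: "t \<in> {1..n}" using t by (simp add: slots_def)
  have kc: "k \<in> cells N" using k active_subset by blast
  show kS: "k \<in> ?S" using t by (auto simp: inverted_cells_def component_def)
  have silent: "X j t = 0" if "t \<notin> slots N s n j" for j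
    using that by (simp add: X_def pam_input codeword_def)
  have embb: "X j t = ?w j" if "j \<in> embb N s" for j
    using that by (auto simp: X_def pam_input embb_def)
  have inactive: "X j t = 0" if "j \<notin> active N s" for j
    using that by (simp add: X_def pam_input)
  show "\<exists>x. x k = ?w k \<and>
      (\<forall>l\<in>?S. channel_output N n X z l t = (\<Sum>j\<in>?S. channel_matrix N j l * x j) + z (l, t))"
  proof (cases "k \<in> urllc N s")
    case True
    let ?I = "\<Sum>j\<in>neighbours N k \<inter> embb N s. gain N j k * ?w j"
    have Xk: "gain N k k * X k t = gain N k k * ?w k - ?I"
    proof -
      have "gain N k k * X k t = gain N k k * ?w k -
          gain N k k * (\<Sum>j\<in>neighbours N k \<inter> embb N s. gain N j k / gain N k k * ?w j)"
        using k t True by (simp add: X_def pam_input algebra_simps)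
      also have "gain N k k * (\<Sum>j\<in>neighbours N k \<inter> embb N s. gain N j k / gain N k k * ?w j) = ?I"
        using direct_gain_nonzero[OF kc] by (simp add: sum_distrib_left)
      finally show ?thesis .
    qed
    \<comment> \<open>URLLC neighbours have another colour and are silent in this slot, and inactive
      ones send nothing. The eMBB sum that remains is the one subtracted in
      \<open>Xk\<close>.\<close>
    have "(\<Sum>j\<in>neighbours N k. gain N j k * X j t) = ?I"
    proof (rule sum.mono_neutral_cong_right)
      show "\<forall>i\<in>neighbours N k - neighbours N k \<inter> embb N s. gain N i k * X i t = 0"
      proof
        fix j assume j: "j \<in> neighbours N k - neighbours N k \<inter> embb N s"
        show "gain N j k * X j t = 0"
        proof (cases "j \<in> active N s")
          case act: True
          then have "j \<in> urllc N s" using j by (auto simp: embb_def)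
          then have "t \<notin> slots N s n j"
            using t True neighbours_colour[of j N k] j by (auto simp: slots_def)
          then show ?thesis using silent by simp
        qed (simp add: inactive)
      qed
    qed (auto simp: embb)
    then have "channel_output N n X z k t = channel_matrix N k k * ?w k + z (k, t)"
      using Xk tn by (simp add: channel_output_def channel_matrix_def)
    then show ?thesis using True by (intro exI[of _ ?w]) (simp add: inverted_cells_def)
  next
    case False
    have "channel_output N n X z l t = (\<Sum>j\<in>?S. channel_matrix N j l * X j t) + z (l, t)"
      if l: "l \<in> ?S" for l
    proof (rule channel_output_restricted[OF tn inverted_cells_subset[OF k] l])
      fix j assume j: "j \<in> neighbours N l" "j \<notin> ?S"
      show "X j t = 0"
      proof (cases "j \<in> active N s")
        case True
        then have "j \<in> component N s k"
          using component_step[OF k _ j(1)] l False by (auto simp: inverted_cells_def)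
        then show ?thesis using j False silent by (auto simp: inverted_cells_def)
      qed (rule inactive)
    qed
    moreover have "X k t = ?w k" using False k embb by (simp add: embb_def)
    ultimately show ?thesis by (intro exI[of _ "\<lambda>j. X j t"]) blast
  qed
qed

text \<open>The inverse returns the spaced symbol plus a combination of noises of size at most
  \<open>a\<close>, which by \<open>noise_margin\<close> is too small to change the
  rounding.\<close>

lemma estimate_correct:
  fixes s m and n :: nat defines "X \<equiv> channel_input N (pam_code N n p) (Suc 0) s m"
  assumes k: "k \<in> active N s" and t: "t \<in> slots N s n k" and good: "t \<notin> bad_times N n a z"
  shows "estimate N n p s k (channel_output N n X z) t = int (book p (slots N s n k) (m k) t)"
proof -
  let ?S = "inverted_cells N n s k t" and ?y = "channel_output N n X z"
  let ?G = "invmat p ?S k" and ?b = "book p (slots N s n k) (m k) t"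
  note sub = inverted_cells_subset[OF k, of n t] and kS = channel_output_inverted(1)[OF k t]
  obtain x where x: "x k = codeword N n p s k (m k) t"
    and y: "\<And>l. l \<in> ?S \<Longrightarrow> ?y l t = (\<Sum>j\<in>?S. channel_matrix N j l * x j) + z (l, t)"
    using channel_output_inverted(2)[OF k t, of m z] unfolding X_def by blast
  have "(\<Sum>l\<in>?S. ?G l * ?y l t) =
      (\<Sum>l\<in>?S. ?G l * (\<Sum>j\<in>?S. channel_matrix N j l * x j)) + (\<Sum>l\<in>?S. ?G l * z (l, t))"
    using y by (simp add: algebra_simps sum.distrib)
  also have "\<dots> = spacing p * real ?b + (\<Sum>l\<in>?S. ?G l * z (l, t))"
    using left_inverse[OF sub kS, of x] x t by (simp add: codeword_def)
  finally have eq: "(\<Sum>l\<in>?S. ?G l * ?y l t) = spacing p * real ?b + (\<Sum>l\<in>?S. ?G l * z (l, t))" .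
  have "\<bar>z (l, t)\<bar> \<le> a" if "l \<in> ?S" for l
    using that sub good t by (force simp: bad_times_def slots_def)
  then have "\<bar>\<Sum>l\<in>?S. ?G l * z (l, t)\<bar> \<le> (\<Sum>l\<in>?S. \<bar>?G l\<bar> * a)"
    by (intro order_trans[OF sum_abs] sum_mono) (auto simp: abs_mult intro!: mult_left_mono)
  also have "\<dots> < spacing p / 2"
    using noise_margin[OF sub kS] by (simp add: sum_distrib_right)
  finally have "\<bar>\<Sum>l\<in>?S. ?G l * z (l, t)\<bar> < spacing p / 2" .
  then have less: "- (spacing p / 2) < (\<Sum>l\<in>?S. ?G l * z (l, t))"
      "(\<Sum>l\<in>?S. ?G l * z (l, t)) < spacing p / 2" by linarith+
  define r where "r = (\<Sum>l\<in>?S. ?G l * z (l, t)) / spacing p"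
  have "-1 / 2 < r" "r < 1 / 2"
    unfolding r_def using less spacing_pos by (simp_all add: less_divide_eq divide_less_eq)
  moreover have "(\<Sum>l\<in>?S. ?G l * ?y l t) / spacing p = real ?b + r"
    using eq spacing_pos by (simp add: r_def field_simps)
  ultimately show ?thesis
    unfolding estimate_def by (intro round_unique) auto
qed

text \<open>Symbol errors in the slots occur at bad times only, so the received word is within
  \<open>radius p\<close> of the sent codeword; by the triangle inequality no other codeword
  is.\<close>

lemma pam_decode_correct:
  fixes s m and n :: nat defines "X \<equiv> channel_input N (pam_code N n p) (Suc 0) s m"
  assumes k: "k \<in> active N s" and few: "card (bad_times N n a z) \<le> radius p"
    and mk: "m k \<in> {1..nmsg p s k}"
    and dist: "\<And>i j. i \<in> {1..nmsg p s k} \<Longrightarrow> j \<in> {1..nmsg p s k} \<Longrightarrow> i \<noteq> j \<Longrightarrow>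
      2 * radius p < hamming (slots N s n k) (book p (slots N s n k) i) (book p (slots N s n k) j)"
  shows "pam_decode N n p s k (channel_output N n X z) = m k"
proof -
  let ?T = "slots N s n k"
  let ?v = "restrict (estimate N n p s k (channel_output N n X z)) {1..n}"
  let ?c = "\<lambda>i t. int (book p ?T i t)"
  have "{t \<in> ?T. ?v t \<noteq> ?c (m k) t} \<subseteq> bad_times N n a z"
    using estimate_correct[OF k, of _ n z m] by (auto simp: X_def slots_def)
  then have "hamming ?T ?v (?c (m k)) \<le> card (bad_times N n a z)"
    unfolding hamming_def by (intro card_mono) (auto simp: bad_times_def)
  with few have near: "hamming ?T ?v (?c (m k)) \<le> radius p" by simp
  have "i = m k" if i: "i \<in> {1..nmsg p s k}" "hamming ?T ?v (?c i) \<le> radius p" for i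
  proof (rule ccontr)
    assume "i \<noteq> m k"
    then have "2 * radius p < hamming ?T (?c i) (?c (m k))"
      using dist[OF i(1) mk] by (simp add: hamming_def)
    also have "\<dots> \<le> hamming ?T (?c i) ?v + hamming ?T ?v (?c (m k))"
      by (rule hamming_triangle) simp
    finally show False using i(2) near by (simp add: hamming_commute)
  qed
  then show ?thesis
    unfolding pam_decode_def nearest_def using mk near by (intro some_equality) blast+
qed

text \<open>A single event, too many bad times, covers the failures of all receivers at once,
  because \<open>bad_times\<close> looks at the noise of the whole network.\<close>

lemma pam_wrong_at_bound:
  assumes mk: "\<And>k. k \<in> active N s \<Longrightarrow> m k \<in> {1..nmsg p s k}"
    and dist: "\<And>k i j. k \<in> active N s \<Longrightarrow> i \<in> {1..nmsg p s k} \<Longrightarrow> j \<in> {1..nmsg p s k} \<Longrightarrow> i \<noteq> j \<Longrightarrow>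
      2 * radius p < hamming (slots N s n k) (book p (slots N s n k) i) (book p (slots N s n k) j)"
  shows "measure (noise N n)
      (\<Union>k\<in>active N s. wrong_at N n (pam_code N n p) (Suc 0) (ncells N * ncells N) s m k)
    \<le> 2 ^ n * (real (ncells N) * measure std_normal {x. a \<le> \<bar>x\<bar>}) ^ Suc (radius p)"
proof -
  interpret prob_space "noise N n" by (rule prob_space_noise)
  obtain E where E: "E \<in> sets (noise N n)"
      "{z \<in> space (noise N n). radius p < card (bad_times N n a z)} \<subseteq> E"
    and mE: "measure (noise N n) E
      \<le> 2 ^ n * (real (ncells N) * measure std_normal {x. a \<le> \<bar>x\<bar>}) ^ Suc (radius p)"
    using many_bad_times[of N n "radius p" a] by blast
  have "(\<Union>k\<in>active N s. wrong_at N n (pam_code N n p) (Suc 0) (ncells N * ncells N) s m k) \<subseteq> E"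
  proof (intro UN_least subsetI)
    fix k z assume k: "k \<in> active N s"
      and z: "z \<in> wrong_at N n (pam_code N n p) (Suc 0) (ncells N * ncells N) s m k"
    then have "radius p < card (bad_times N n a z)"
      using pam_decode_correct[OF k, of n z m] mk[OF k] dist[OF k]
      by (cases "card (bad_times N n a z) \<le> radius p") (simp_all add: wrong_at_def pam_decision)
    then show "z \<in> E" using E(2) z by (auto simp: wrong_at_def)
  qed
  then have "measure (noise N n)
      (\<Union>k\<in>active N s. wrong_at N n (pam_code N n p) (Suc 0) (ncells N * ncells N) s m k) \<le> measure (noise N n) E"
    using E(1) by (rule finite_measure_mono)
  with mE show ?thesis by linarith
qed

lemma pam_errors_measurable:
  "errors_measurable \<rho> \<rho>\<^sub>f N n RU RE (Suc 0) (ncells N * ncells N) (pam_code N n p)"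
proof -
  have "wrong_at N n (pam_code N n p) (Suc 0) (ncells N * ncells N) s m k \<in> sets (noise N n)"
    if "k \<in> active N s" for s m k
    using measurable_pam_error[OF that] by (simp add: wrong_at_def pam_decision[OF that])
  then show ?thesis by (auto simp: errors_measurable_def)
qed

text \<open>A peak bound at every time: a symbol has amplitude at most
  \<open>spacing p * real M\<close>, and precancellation adds at most that times a sum of gain
  ratios. Summing over all pairs of cells makes the factor independent of \<open>k\<close>.\<close>

lemma pam_power_constraint:
  assumes M: "\<And>T i t. book p T i t < M"
    and P: "0 \<le> P" "spacing p * real M * (1 + (\<Sum>j\<in>cells N. \<Sum>k\<in>cells N. \<bar>gain N j k / gain N k k\<bar>)) \<le> sqrt P"
    and n: "1 \<le> n"
  shows "power_constraint \<rho> \<rho>\<^sub>f N P n RU RE (Suc 0) (pam_code N n p)"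
proof -
  let ?A = "spacing p * real M"
  have cw: "\<bar>codeword N n p s k i t\<bar> \<le> ?A" for s k i t
    using M[of "slots N s n k" i t] spacing_pos by (auto simp: codeword_def abs_mult intro!: mult_left_mono)
  have "(channel_input N (pam_code N n p) (Suc 0) s m k t)\<^sup>2 \<le> P" if k: "k \<in> active N s" for s m k t
  proof -
    have kc: "k \<in> cells N" using k active_subset by blast
    let ?J = "neighbours N k \<inter> embb N s"
    let ?w = "\<lambda>j. codeword N n p s j (m j) t"
    have "\<bar>\<Sum>j\<in>?J. gain N j k / gain N k k * ?w j\<bar> \<le> (\<Sum>j\<in>?J. \<bar>gain N j k / gain N k k\<bar> * ?A)"
      by (intro order_trans[OF sum_abs] sum_mono) (subst abs_mult, rule mult_left_mono[OF cw], simp)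
    also have "\<dots> \<le> (\<Sum>j\<in>cells N. \<bar>gain N j k / gain N k k\<bar> * ?A)"
      using neighbours_subset spacing_pos by (intro sum_mono2) auto
    also have "\<dots> \<le> (\<Sum>j\<in>cells N. (\<Sum>k\<in>cells N. \<bar>gain N j k / gain N k k\<bar>) * ?A)"
      using kc spacing_pos by (intro sum_mono mult_right_mono member_le_sum) auto
    also have "\<dots> = (\<Sum>j\<in>cells N. \<Sum>k\<in>cells N. \<bar>gain N j k / gain N k k\<bar>) * ?A"
      by (simp add: sum_distrib_right)
    finally have I: "\<bar>\<Sum>j\<in>?J. gain N j k / gain N k k * ?w j\<bar> \<le> \<dots>" .
    have "\<bar>channel_input N (pam_code N n p) (Suc 0) s m k t\<bar>
        \<le> \<bar>?w k\<bar> + \<bar>\<Sum>j\<in>?J. gain N j k / gain N k k * ?w j\<bar>"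
      unfolding pam_input by auto
    also have "\<dots> \<le> ?A + (\<Sum>j\<in>cells N. \<Sum>k\<in>cells N. \<bar>gain N j k / gain N k k\<bar>) * ?A"
      by (intro add_mono cw I)
    also have "\<dots> \<le> sqrt P" using P(2) by (simp add: algebra_simps)
    finally show ?thesis using P(1) by (metis real_sqrt_abs real_sqrt_le_iff)
  qed
  then have "1 / real n * (\<Sum>t=1..n. (channel_input N (pam_code N n p) (Suc 0) s m k t)\<^sup>2) \<le> P"
    if "k \<in> active N s" for s m k
    using sum_bounded_above[of "{1..n}" "\<lambda>t. (channel_input N (pam_code N n p) (Suc 0) s m k t)\<^sup>2" P] that n
    by (simp add: field_simps)
  then show ?thesis unfolding power_constraint_def by (intro AE_I2) auto
qed

end

section \<open>Message source and average error probability\<close>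

lemma source_message:
  assumes "(s, m) \<in> set_pmf (source_pmf \<rho> \<rho>\<^sub>f N n RU RE)" "0 \<le> RU" "\<And>s k. 0 \<le> RE s k" "k \<in> active N s"
  shows "m k \<in> {1..nat \<lfloor>2 powr (real n * (if k \<in> urllc N s then RU else RE s k))\<rfloor>}"
proof -
  let ?L = "\<lambda>k. nat \<lfloor>2 powr (real n * (if k \<in> urllc N s then RU else RE s k))\<rfloor>"
  have fin: "finite (active N s)" using active_subset finite_cells by (rule finite_subset)
  \<comment> \<open>Nonnegative rates keep the message sets nonempty, as \<open>pmf_of_set\<close>
    requires.\<close>
  have "1 \<le> (2::real) powr (real n * (if k \<in> urllc N s then RU else RE s k))"
    using assms by (intro ge_one_powr_ge_zero) auto
  then have "1 \<le> ?L k" by linarith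
  then have "set_pmf (pmf_of_set {1..?L k}) = {1..?L k}" by (intro set_pmf_of_set) auto
  moreover have "m \<in> set_pmf (message_pmf N n RU RE s)"
    using assms(1) by (auto simp: source_pmf_def)
  then have "m \<in> PiE_dflt (active N s) 0 (\<lambda>k. set_pmf (pmf_of_set {1..?L k}))"
    unfolding message_pmf_def using fin by (simp add: set_Pi_pmf comp_def)
  then have "m k \<in> set_pmf (pmf_of_set {1..?L k})" using assms(4) by (auto simp: PiE_dflt_def)
  ultimately show ?thesis by simp
qed

lemma error_prob_le:
  assumes "\<And>s m. (s, m) \<in> set_pmf (source_pmf \<rho> \<rho>\<^sub>f N n RU RE) \<Longrightarrow>
     measure (noise N n) (\<Union>k\<in>active N s. wrong_at N n c DT DR s m k) \<le> B"
  shows "error_prob \<rho> \<rho>\<^sub>f N n RU RE DT DR c \<le> B"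
proof -
  interpret noise: prob_space "noise N n" by (rule prob_space_noise)
  show ?thesis unfolding error_prob_def
    by (rule measure_pmf.integral_le_const)
       (auto intro!: AE_pmfI measure_pmf.integrable_const_bound[where B = 1] assms)
qed

lemma error_prob_nonneg: "0 \<le> error_prob \<rho> \<rho>\<^sub>f N n RU RE DT DR c"
  unfolding error_prob_def by (intro integral_nonneg_AE) auto

subsection \<open>Rates and multiplexing gains\<close>

text \<open>The base-2 logarithm of the Gilbert-Varshamov condition at distance
  \<open>2 * e\<close>. Per time, \<open>R\<close> pays for the messages, \<open>1\<close> for the
  position sets of the ball and \<open>2 * \<delta> * lM\<close> for the symbols on them.\<close>

lemma codebook_size:
  fixes R lM \<delta> :: real
  assumes M: "1 \<le> M" "lM = log 2 (real M)" and e: "real e \<le> \<delta> * real n"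
    and T: "T \<le> n" and rate: "real n * (R + 1 + 2 * \<delta> * lM) \<le> real T * lM"
  shows "nat \<lfloor>2 powr (real n * R)\<rfloor> * (2 ^ T * M ^ (2 * e)) \<le> M ^ T"
proof -
  have M2: "real M = 2 powr lM" using M by simp
  have l0: "0 \<le> lM" using M by simp
  have pw: "real M ^ i = 2 powr (real i * lM)" for i
    by (simp add: M2 powr_power mult.commute)
  have "real (nat \<lfloor>2 powr (real n * R)\<rfloor>) \<le> 2 powr (real n * R)" by simp
  moreover have "(2::real) ^ T \<le> 2 powr real n" using T by (simp add: powr_realpow[symmetric])
  moreover have "real M ^ (2 * e) \<le> 2 powr (2 * (\<delta> * real n) * lM)"
    unfolding pw using e l0 by (intro powr_mono mult_right_mono) auto
  ultimately have "real (nat \<lfloor>2 powr (real n * R)\<rfloor>) * (2 ^ T * real M ^ (2 * e))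
      \<le> 2 powr (real n * R) * (2 powr real n * 2 powr (2 * (\<delta> * real n) * lM))"
    by (intro mult_mono) auto
  also have "\<dots> = 2 powr (real n * (R + 1 + 2 * \<delta> * lM))"
    by (simp add: powr_add[symmetric] algebra_simps)
  also have "\<dots> \<le> real M ^ T" unfolding pw using rate by (intro powr_mono) auto
  finally have "real (nat \<lfloor>2 powr (real n * R)\<rfloor> * (2 ^ T * M ^ (2 * e))) \<le> real (M ^ T)" by simp
  then show ?thesis by (simp only: of_nat_le_iff)
qed

text \<open>\<open>\<Delta>\<close> and \<open>G\<close> are fixed by the network and
  \<open>a\<close>, before book, message counts and radius, so the spacing stays the same as
  blocklength and power grow. \<open>c\<close> bounds the row sums of the finitely many
  inverses.\<close>

lemma pam_scheme_exists:
  assumes "nondegenerate N"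
  shows "\<exists>\<Delta> G. \<forall>b L e. pam_scheme N \<lparr>spacing = \<Delta>, book = b, invmat = G, nmsg = L, radius = e\<rparr> a \<and> 0 < \<Delta>"
proof -
  obtain G where G: "\<And>S i x. S \<subseteq> cells N \<Longrightarrow> i \<in> S \<Longrightarrow>
      x i = (\<Sum>k\<in>S. G S i k * (\<Sum>j\<in>S. channel_matrix N j k * x j))"
    using nondegenerate_left_inverse[OF assms] by (elim exE) blast
  define c where "c = (\<Sum>S\<in>Pow (cells N). \<Sum>i\<in>cells N. \<Sum>k\<in>S. \<bar>G S i k\<bar>)"
  have c: "(\<Sum>k\<in>S. \<bar>G S i k\<bar>) \<le> c" if "S \<subseteq> cells N" "i \<in> S" for S i
  proof -
    have "(\<Sum>k\<in>S. \<bar>G S i k\<bar>) \<le> (\<Sum>i\<in>cells N. \<Sum>k\<in>S. \<bar>G S i k\<bar>)"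
      using that by (intro member_le_sum[where f = "\<lambda>i. \<Sum>k\<in>S. \<bar>G S i k\<bar>"]) (auto intro: sum_nonneg)
    also have "\<dots> \<le> c" unfolding c_def
      using that by (intro member_le_sum[where f = "\<lambda>S. \<Sum>i\<in>cells N. \<Sum>k\<in>S. \<bar>G S i k\<bar>"])
        (auto intro: sum_nonneg)
    finally show ?thesis .
  qed
  have c0: "0 \<le> c" unfolding c_def by (intro sum_nonneg) auto
  \<comment> \<open>The summand 1 makes the margin strict and the spacing positive even if
    \<open>c\<close> or \<open>a\<close> is 0.\<close>
  define \<Delta> where "\<Delta> = 2 * c * \<bar>a\<bar> + 1"
  have D: "0 < \<Delta>" using c0 by (simp add: \<Delta>_def add_nonneg_pos)
  have "pam_scheme N \<lparr>spacing = \<Delta>, book = b, invmat = G, nmsg = L, radius = e\<rparr> a" for b L e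
  proof
    fix S i assume S: "S \<subseteq> cells N" "i \<in> S"
    have "(\<Sum>k\<in>S. \<bar>G S i k\<bar>) * a \<le> (\<Sum>k\<in>S. \<bar>G S i k\<bar>) * \<bar>a\<bar>"
      by (intro mult_left_mono sum_nonneg) auto
    also have "\<dots> \<le> c * \<bar>a\<bar>" using c[OF S] by (intro mult_right_mono) auto
    also have "\<dots> < \<Delta> / 2" by (simp add: \<Delta>_def)
    finally show "(\<Sum>k\<in>S. \<bar>invmat \<lparr>spacing = \<Delta>, book = b, invmat = G, nmsg = L, radius = e\<rparr> S i k\<bar>) * a
        < spacing \<lparr>spacing = \<Delta>, book = b, invmat = G, nmsg = L, radius = e\<rparr> / 2" by simp
  next
    fix S i and x :: "nat \<Rightarrow> real" assume "S \<subseteq> cells N" "i \<in> S"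
    then show "x i = (\<Sum>k\<in>S. invmat \<lparr>spacing = \<Delta>, book = b, invmat = G, nmsg = L, radius = e\<rparr> S i k *
        (\<Sum>j\<in>S. channel_matrix N j k * x j))" unfolding pam_params.simps by (rule G)
  qed (use D in simp)
  with D show ?thesis by blast
qed

lemma small_tail:
  fixes r :: real
  assumes "0 < r"
  shows "\<exists>a. real K * measure std_normal {x. a \<le> \<bar>x\<bar>} \<le> r"
proof -
  have "(\<lambda>i. real K * measure std_normal {x. real i \<le> \<bar>x\<bar>}) \<longlonglongrightarrow> real K * 0"
    by (intro tendsto_mult_left std_normal_tail)
  then have "\<forall>\<^sub>F i in sequentially. real K * measure std_normal {x. real i \<le> \<bar>x\<bar>} < r"
    using assms by (intro order_tendstoD(2)) auto
  then obtain i where "real K * measure std_normal {x. real i \<le> \<bar>x\<bar>} < r"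
    by (auto simp: eventually_sequentially)
  then show ?thesis by (intro exI[of _ "real i"]) simp
qed

text \<open>The constant \<open>\<kappa>\<close> depends on the network and on \<open>\<delta>\<close> only, so an alphabet of size
  \<open>M = \<lfloor>sqrt P / \<kappa>\<rfloor>\<close> loses only a bounded rate against \<open>log 2 P / 2\<close>.\<close>

lemma pam_achieves:
  assumes N: "nondegenerate N" and \<delta>: "0 < \<delta>"
  shows "\<exists>\<kappa>>0. \<forall>M P RU R. 1 \<le> M \<longrightarrow> \<kappa> * real M \<le> sqrt P \<longrightarrow> 0 \<le> RU \<longrightarrow> 0 \<le> R \<longrightarrow>
     RU + 1 + 2 * \<delta> * log 2 (real M) < log 2 (real M) / 3 \<longrightarrow>
     R + 1 + 2 * \<delta> * log 2 (real M) < log 2 (real M) \<longrightarrow>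
     (\<exists>DT DR. \<exists>c :: nat \<Rightarrow> code.
        (\<forall>n\<ge>1. power_constraint \<rho> \<rho>\<^sub>f N P n RU (\<lambda>_ _. R) DT (c n) \<and>
               errors_measurable \<rho> \<rho>\<^sub>f N n RU (\<lambda>_ _. R) DT DR (c n)) \<and>
        (\<lambda>n. error_prob \<rho> \<rho>\<^sub>f N n RU (\<lambda>_ _. R) DT DR (c n)) \<longlonglongrightarrow> 0)"
proof -
  \<comment> \<open>Chosen so that \<open>r powr (\<delta> * real n)\<close> is
    \<open>(1/4) ^ n\<close>, which beats the factor \<open>2 ^ n\<close> of the union
    bound.\<close>
  define r :: real where "r = (1/4) powr (1/\<delta>)"
  have r: "0 < r" "r \<le> 1" using \<delta> by (auto simp: r_def powr_le1)
  obtain a where a: "real (ncells N) * measure std_normal {x. a \<le> \<bar>x\<bar>} \<le> r"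
    using small_tail[OF r(1)] by blast
  obtain \<Delta> G where pam: "\<And>b L e. pam_scheme N \<lparr>spacing = \<Delta>, book = b, invmat = G, nmsg = L, radius = e\<rparr> a"
    and D: "0 < \<Delta>"
    using pam_scheme_exists[OF N, of a] by blast
  define \<kappa> where "\<kappa> = \<Delta> * (1 + (\<Sum>j\<in>cells N. \<Sum>k\<in>cells N. \<bar>gain N j k / gain N k k\<bar>))"
  have \<kappa>: "0 < \<kappa>" unfolding \<kappa>_def using D
    by (intro mult_pos_pos add_pos_nonneg sum_nonneg) auto
  define e where "e n = nat \<lfloor>\<delta> * real n\<rfloor>" for n
  have e: "real (e n) \<le> \<delta> * real n" "\<delta> * real n \<le> real (Suc (e n))" for n
  proof -
    have "0 \<le> \<delta> * real n" using \<delta> by simp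
    then show "real (e n) \<le> \<delta> * real n" "\<delta> * real n \<le> real (Suc (e n))"
      unfolding e_def by linarith+
  qed
  show ?thesis
  proof (intro exI[of _ \<kappa>] conjI \<kappa> allI impI)
    fix M :: nat and P RU R :: real
    assume M: "1 \<le> M" and P: "\<kappa> * real M \<le> sqrt P" and R: "0 \<le> RU" "0 \<le> R"
    define lM where "lM = log 2 (real M)"
    assume "RU + 1 + 2 * \<delta> * log 2 (real M) < log 2 (real M) / 3"
      "R + 1 + 2 * \<delta> * log 2 (real M) < log 2 (real M)"
    then have rates: "RU + 1 + 2 * \<delta> * lM < lM / 3" "R + 1 + 2 * \<delta> * lM < lM" by (simp_all add: lM_def)
    define L where "L = (\<lambda>n s k. nat \<lfloor>2 powr (real n * (if k \<in> urllc N s then RU else R))\<rfloor>)"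
    define good where "good = (\<lambda>n T (b :: nat \<Rightarrow> nat \<Rightarrow> nat). (\<forall>i t. b i t < M) \<and>
        (finite T \<longrightarrow> (\<forall>L. L * (2 ^ card T * M ^ (2 * e n)) \<le> M ^ card T \<longrightarrow>
          (\<forall>i\<in>{1..L}. \<forall>j\<in>{1..L}. i \<noteq> j \<longrightarrow> 2 * e n < hamming T (b i) (b j)))))"
    have "\<exists>b. good n T b" for n T
    proof (cases "finite T")
      case True
      then show ?thesis using codebook_exists[OF True M, of "2 * e n"] by (simp add: good_def)
    qed (use M in \<open>auto simp: good_def intro!: exI[of _ "\<lambda>_ _. 0"]\<close>)
    then obtain b where good: "\<And>n T. good n T (b n T)" by metis
    have bM: "b n T i t < M" for n T i t using good[of n T] by (simp add: good_def)
    have b: "2 * e n < hamming T (b n T i) (b n T j)"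
      if "finite T" "L * (2 ^ card T * M ^ (2 * e n)) \<le> M ^ card T"
        "i \<in> {1..L}" "j \<in> {1..L}" "i \<noteq> j" for n T L i j
      using good[of n T] that unfolding good_def by blast
    define p where "p n = \<lparr>spacing = \<Delta>, book = b n, invmat = G, nmsg = L n, radius = e n\<rparr>" for n
    let ?c = "\<lambda>n. pam_code N n (p n)" and ?DR = "ncells N * ncells N"
    have pam: "pam_scheme N (p n) a" for n unfolding p_def by (rule pam)
    have P0: "0 \<le> P"
    proof -
      have "0 \<le> \<kappa> * real M" using \<kappa> by simp
      then have "0 \<le> sqrt P" using P by linarith
      then show ?thesis by simp
    qed
    have power: "power_constraint \<rho> \<rho>\<^sub>f N P n RU (\<lambda>_ _. R) (Suc 0) (?c n)" if "1 \<le> n" for n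
      by (rule pam_scheme.pam_power_constraint[OF pam, where M = M])
        (use bM P0 P that in \<open>auto simp: p_def \<kappa>_def algebra_simps\<close>)
    have meas: "errors_measurable \<rho> \<rho>\<^sub>f N n RU (\<lambda>_ _. R) (Suc 0) ?DR (?c n)" for n
      by (rule pam_scheme.pam_errors_measurable[OF pam])
    \<comment> \<open>From \<open>n0\<close> on, the slack in the URLLC rate pays for the one slot
      lost in \<open>card_slots_urllc\<close>. Smaller blocklengths do not affect the limit.\<close>
    obtain n0 :: nat where n0: "lM / (lM / 3 - (RU + 1 + 2 * \<delta> * lM)) \<le> real n0"
      using real_arch_simple by blast
    have bound: "error_prob \<rho> \<rho>\<^sub>f N n RU (\<lambda>_ _. R) (Suc 0) ?DR (?c n) \<le> (1/2) ^ n" if n: "n0 \<le> n" for n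
    proof (rule error_prob_le)
      fix s m assume sm: "(s, m) \<in> set_pmf (source_pmf \<rho> \<rho>\<^sub>f N n RU (\<lambda>_ _. R))"
      have size: "nmsg (p n) s k * (2 ^ card (slots N s n k) * M ^ (2 * e n)) \<le> M ^ card (slots N s n k)" for k
      proof -
        have T: "card (slots N s n k) \<le> n"
        proof -
          have "slots N s n k \<subseteq> {1..n}" by (auto simp: slots_def)
          then show ?thesis using card_mono[of "{1..n}" "slots N s n k"] by simp
        qed
        have l0: "0 \<le> lM" using M by (simp add: lM_def)
        have "real n * ((if k \<in> urllc N s then RU else R) + 1 + 2 * \<delta> * lM) \<le> real (card (slots N s n k)) * lM"
        proof (cases "k \<in> urllc N s")
          case True
          have "lM / (lM / 3 - (RU + 1 + 2 * \<delta> * lM)) \<le> real n" using n0 n by linarith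
          then have "lM \<le> real n * (lM / 3 - (RU + 1 + 2 * \<delta> * lM))"
            using rates(1) by (simp add: pos_divide_le_eq)
          then have "real n * (RU + 1 + 2 * \<delta> * lM) \<le> (real n / 3 - 1) * lM" by (simp add: algebra_simps)
          also have "\<dots> \<le> real (card (slots N s n k)) * lM"
            using card_slots_urllc l0 by (rule mult_right_mono)
          finally show ?thesis using True by simp
        next
          case False
          then show ?thesis using rates(2) by (simp add: card_slots_embb mult_left_mono)
        qed
        from codebook_size[OF M lM_def e(1) T this] show ?thesis by (simp add: p_def L_def)
      qed
      let ?x = "real (ncells N) * measure std_normal {x. a \<le> \<bar>x\<bar>}"
      have "measure (noise N n) (\<Union>k\<in>active N s. wrong_at N n (?c n) (Suc 0) ?DR s m k)
          \<le> 2 ^ n * ?x ^ Suc (radius (p n))"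
      proof (rule pam_scheme.pam_wrong_at_bound[OF pam])
        fix k assume k: "k \<in> active N s"
        show "m k \<in> {1..nmsg (p n) s k}"
          using source_message[OF sm R(1) _ k] R(2) by (simp add: p_def L_def)
        fix i j assume "i \<in> {1..nmsg (p n) s k}" "j \<in> {1..nmsg (p n) s k}" "i \<noteq> j"
        then show "2 * radius (p n) <
            hamming (slots N s n k) (book (p n) (slots N s n k) i) (book (p n) (slots N s n k) j)"
          using b[OF finite_slots size] by (simp add: p_def)
      qed
      also have "?x ^ Suc (radius (p n)) \<le> r ^ Suc (e n)"
        unfolding p_def pam_params.simps by (intro power_mono a) simp
      also have "r ^ Suc (e n) = r powr real (Suc (e n))" using r by (simp add: powr_realpow del: of_nat_Suc)
      \<comment> \<open>As \<open>r \<le> 1\<close>, the exponent may be lowered from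
        \<open>Suc (e n)\<close>; the floor \<open>e n\<close> alone could fall short of
        \<open>\<delta> * real n\<close>.\<close>
      also have "\<dots> \<le> r powr (\<delta> * real n)" using r e(2)[of n] by (intro powr_mono') auto
      also have "\<dots> = (1/4) ^ n" using \<delta> by (simp add: r_def powr_powr powr_realpow)
      also have "2 ^ n * (1/4) ^ n = (1/2 :: real) ^ n" by (simp add: power_mult_distrib[symmetric])
      finally show "measure (noise N n) (\<Union>k\<in>active N s. wrong_at N n (?c n) (Suc 0) ?DR s m k) \<le> (1/2) ^ n"
        by simp
    qed
    have lim: "(\<lambda>n. error_prob \<rho> \<rho>\<^sub>f N n RU (\<lambda>_ _. R) (Suc 0) ?DR (?c n)) \<longlonglongrightarrow> 0"
    proof (rule tendsto_sandwich[OF _ _ tendsto_const])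
      show "\<forall>\<^sub>F n in sequentially. 0 \<le> error_prob \<rho> \<rho>\<^sub>f N n RU (\<lambda>_ _. R) (Suc 0) ?DR (?c n)"
        by (simp add: error_prob_nonneg)
      show "\<forall>\<^sub>F n in sequentially. error_prob \<rho> \<rho>\<^sub>f N n RU (\<lambda>_ _. R) (Suc 0) ?DR (?c n) \<le> (1/2) ^ n"
        using bound by (auto simp: eventually_sequentially)
      show "(\<lambda>n. (1/2 :: real) ^ n) \<longlonglongrightarrow> 0" by (rule LIMSEQ_power_zero) simp
    qed
    show "\<exists>DT DR. \<exists>c :: nat \<Rightarrow> code.
        (\<forall>n\<ge>1. power_constraint \<rho> \<rho>\<^sub>f N P n RU (\<lambda>_ _. R) DT (c n) \<and>
               errors_measurable \<rho> \<rho>\<^sub>f N n RU (\<lambda>_ _. R) DT DR (c n)) \<and>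
        (\<lambda>n. error_prob \<rho> \<rho>\<^sub>f N n RU (\<lambda>_ _. R) DT DR (c n)) \<longlonglongrightarrow> 0"
      by (intro exI[of _ "Suc 0"] exI[of _ ?DR] exI[of _ ?c] conjI allI impI power meas lim)
  qed
qed

section \<open>Expected eMBB rate\<close>

lemma embb_pmf:
  assumes "0 \<le> \<rho>" "\<rho> \<le> 1" "0 \<le> \<rho>\<^sub>f" "\<rho>\<^sub>f \<le> 1"
  shows "pmf (cell_activity_pmf \<rho> \<rho>\<^sub>f) (True, False) = \<rho> * (1 - \<rho>\<^sub>f)"
proof -
  have "pmf (map_pmf (Pair True) (bernoulli_pmf \<rho>\<^sub>f)) (True, False) = 1 - \<rho>\<^sub>f"
    using assms pmf_map_inj'[of "Pair True" "bernoulli_pmf \<rho>\<^sub>f" False] by (simp add: inj_on_def)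
  then show ?thesis using assms by (simp add: cell_activity_pmf_def pmf_bind)
qed

lemma expected_embb_rate:
  assumes "0 \<le> \<rho>" "\<rho> \<le> 1" "0 \<le> \<rho>\<^sub>f" "\<rho>\<^sub>f \<le> 1" "1 \<le> ncells N"
  shows "measure_pmf.expectation (activity_pmf \<rho> \<rho>\<^sub>f N)
     (\<lambda>s. 1 / real (ncells N) * (\<Sum>k\<in>embb N s. R)) = R * (\<rho> * (1 - \<rho>\<^sub>f))"
proof -
  let ?p = "activity_pmf \<rho> \<rho>\<^sub>f N"
  have fin: "finite (set_pmf ?p)" unfolding activity_pmf_def
    by (subst set_Pi_pmf) (auto intro!: finite_PiE_dflt finite)
  have prob: "measure_pmf.expectation ?p (\<lambda>s. indicator {(True, False)} (s k)) = \<rho> * (1 - \<rho>\<^sub>f)"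
    if "k \<in> cells N" for k
  proof -
    have "map_pmf (\<lambda>s. s k) ?p = cell_activity_pmf \<rho> \<rho>\<^sub>f"
      unfolding activity_pmf_def using that by (simp add: Pi_pmf_component)
    then have "pmf (cell_activity_pmf \<rho> \<rho>\<^sub>f) (True, False) =
        measure_pmf.expectation (map_pmf (\<lambda>s. s k) ?p) (indicator {(True, False)})"
      by (simp add: measure_pmf_single)
    also have "\<dots> = measure_pmf.expectation ?p (\<lambda>s. indicator {(True, False)} (s k))"
      by (rule integral_map_pmf)
    finally show ?thesis using assms by (simp add: embb_pmf)
  qed
  have "(\<Sum>k\<in>embb N s. R) = (\<Sum>k\<in>cells N. R * indicator {(True, False)} (s k))" for s
    by (rule sum.mono_neutral_cong_left)
       (auto simp: embb_def active_def urllc_def prod_eq_iff split: split_indicator)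
  then have "measure_pmf.expectation ?p (\<lambda>s. 1 / real (ncells N) * (\<Sum>k\<in>embb N s. R)) =
      1 / real (ncells N) * measure_pmf.expectation ?p (\<lambda>s. \<Sum>k\<in>cells N. R * indicator {(True, False)} (s k))"
    by (simp only: integral_mult_right_zero)
  also have "measure_pmf.expectation ?p (\<lambda>s. \<Sum>k\<in>cells N. R * indicator {(True, False)} (s k)) =
      (\<Sum>k\<in>cells N. measure_pmf.expectation ?p (\<lambda>s. R * indicator {(True, False)} (s k)))"
    by (rule Bochner_Integration.integral_sum) (rule integrable_measure_pmf_finite[OF fin])
  also have "\<dots> = (\<Sum>k\<in>cells N. R * (\<rho> * (1 - \<rho>\<^sub>f)))"
    by (intro sum.cong refl) (simp only: integral_mult_right_zero prob)
  also have "1 / real (ncells N) * \<dots> = R * (\<rho> * (1 - \<rho>\<^sub>f))"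
    using assms(5) by (simp add: cells_def)
  finally show ?thesis .
qed

text \<open>With \<open>u\<close> for half of \<open>log 2 P\<close>, the alphabet carries at least
  \<open>u - h\<close> bits, so the rates can grow with slopes \<open>1/3 - 2 * \<delta>\<close> and
  \<open>1 - 2 * \<delta>\<close> in \<open>u\<close>. These exceed the targets, and large
  \<open>u\<close> absorbs the constants.\<close>

lemma achievable_rates_high_power:
  assumes \<rho>: "0 \<le> \<rho>" "\<rho> \<le> 1" "0 \<le> \<rho>\<^sub>f" "\<rho>\<^sub>f \<le> 1"
    and N: "1 \<le> ncells N" "nondegenerate N"
    and \<theta>: "0 \<le> \<theta>\<^sub>U" "\<theta>\<^sub>U < 1/3" "0 \<le> \<theta>\<^sub>e" "\<theta>\<^sub>e < 1"
  shows "\<exists>P0. \<forall>P\<ge>P0. achievable_rates \<rho> \<rho>\<^sub>f N P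
     (\<theta>\<^sub>U * (1/2 * log 2 P)) (\<theta>\<^sub>e * (\<rho> * (1 - \<rho>\<^sub>f)) * (1/2 * log 2 P))"
proof -
  define \<delta> where "\<delta> = min (1/3 - \<theta>\<^sub>U) (1 - \<theta>\<^sub>e) / 4"
  have \<delta>: "0 < \<delta>" "\<theta>\<^sub>U < 1/3 - 2 * \<delta>" "\<theta>\<^sub>e < 1 - 2 * \<delta>"
  proof -
    show "0 < \<delta>" using \<theta> by (simp add: \<delta>_def)
    have "4 * \<delta> \<le> 1/3 - \<theta>\<^sub>U" "4 * \<delta> \<le> 1 - \<theta>\<^sub>e" by (simp_all add: \<delta>_def)
    with \<open>0 < \<delta>\<close> show "\<theta>\<^sub>U < 1/3 - 2 * \<delta>" "\<theta>\<^sub>e < 1 - 2 * \<delta>" by linarith+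
  qed
  obtain \<kappa> where \<kappa>: "0 < \<kappa>" and ach: "\<And>M P RU R. 1 \<le> M \<Longrightarrow> \<kappa> * real M \<le> sqrt P \<Longrightarrow> 0 \<le> RU \<Longrightarrow> 0 \<le> R \<Longrightarrow>
     RU + 1 + 2 * \<delta> * log 2 (real M) < log 2 (real M) / 3 \<Longrightarrow>
     R + 1 + 2 * \<delta> * log 2 (real M) < log 2 (real M) \<Longrightarrow>
     (\<exists>DT DR. \<exists>c :: nat \<Rightarrow> code.
        (\<forall>n\<ge>1. power_constraint \<rho> \<rho>\<^sub>f N P n RU (\<lambda>_ _. R) DT (c n) \<and>
               errors_measurable \<rho> \<rho>\<^sub>f N n RU (\<lambda>_ _. R) DT DR (c n)) \<and>
        (\<lambda>n. error_prob \<rho> \<rho>\<^sub>f N n RU (\<lambda>_ _. R) DT DR (c n)) \<longlonglongrightarrow> 0)"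
    using pam_achieves[OF N(2) \<delta>(1), of \<rho> \<rho>\<^sub>f] by (elim exE conjE) simp
  \<comment> \<open>\<open>\<kappa>\<close> accounts for spacing and precancellation, the factor 2
    for rounding \<open>sqrt P / \<kappa>\<close> down to an integer.\<close>
  define h where "h = log 2 (2 * \<kappa>)"
  \<comment> \<open>In order, the entries secure \<open>u \<ge> 0\<close>, \<open>M \<ge> 1\<close>
    and the two rate conditions, made strict by \<open>+ 1\<close>.\<close>
  define u0 where "u0 = Max {0, log 2 \<kappa>, (1 + (1/3 - 2 * \<delta>) * h) / (1/3 - 2 * \<delta> - \<theta>\<^sub>U) + 1,
      (1 + (1 - 2 * \<delta>) * h) / (1 - 2 * \<delta> - \<theta>\<^sub>e) + 1}"
  show ?thesis
  proof (intro exI[of _ "2 powr (2 * u0)"] allI impI)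
    fix P :: real assume P: "2 powr (2 * u0) \<le> P"
    define u where "u = 1/2 * log 2 P"
    have P0: "0 < P" using P powr_gt_zero[of 2 "2 * u0"] by linarith
    have "2 * u0 \<le> log 2 P" using P P0 by (simp add: le_log_iff)
    then have "u0 \<le> u" by (simp add: u_def)
    then have u: "0 \<le> u" "log 2 \<kappa> \<le> u" "(1 + (1/3 - 2 * \<delta>) * h) / (1/3 - 2 * \<delta> - \<theta>\<^sub>U) < u"
      "(1 + (1 - 2 * \<delta>) * h) / (1 - 2 * \<delta> - \<theta>\<^sub>e) < u"
      by (auto simp: u0_def)
    have sq: "sqrt P = 2 powr u" using P0 by (simp add: u_def powr_half_sqrt[symmetric] powr_def log_def)
    define M where "M = nat \<lfloor>sqrt P / \<kappa>\<rfloor>"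
    have "1 \<le> sqrt P / \<kappa>"
      using u(2) \<kappa> by (simp add: sq log_le_iff)
    then have M: "1 \<le> M" "real M \<le> sqrt P / \<kappa>" and "sqrt P / \<kappa> \<le> real M + 1"
      unfolding M_def by linarith+
    then have M2: "sqrt P / \<kappa> / 2 \<le> real M" by simp
    have "u - h = log 2 (sqrt P / \<kappa> / 2)"
      using \<kappa> P0 by (simp add: sq h_def log_divide log_mult)
    also have "\<dots> \<le> log 2 (real M)" using M2 \<kappa> P0 by (intro log_mono) auto
    finally have lM: "u - h \<le> log 2 (real M)" .
    have "1 + (1/3 - 2 * \<delta>) * h < u * (1/3 - 2 * \<delta> - \<theta>\<^sub>U)"
      using u(3) \<delta>(2) by (simp add: pos_divide_less_eq)
    then have "\<theta>\<^sub>U * u + 1 < (1/3 - 2 * \<delta>) * (u - h)"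
      by (simp add: algebra_simps diff_divide_distrib)
    also have "\<dots> \<le> (1/3 - 2 * \<delta>) * log 2 (real M)" using lM \<delta> \<theta> by (intro mult_left_mono) auto
    finally have rU: "\<theta>\<^sub>U * u + 1 + 2 * \<delta> * log 2 (real M) < log 2 (real M) / 3" by (simp add: algebra_simps)
    have "1 + (1 - 2 * \<delta>) * h < u * (1 - 2 * \<delta> - \<theta>\<^sub>e)"
      using u(4) \<delta>(3) by (simp add: pos_divide_less_eq)
    then have "\<theta>\<^sub>e * u + 1 < (1 - 2 * \<delta>) * (u - h)" by (simp add: algebra_simps)
    also have "\<dots> \<le> (1 - 2 * \<delta>) * log 2 (real M)" using lM \<delta> \<theta> by (intro mult_left_mono) auto
    finally have re: "\<theta>\<^sub>e * u + 1 + 2 * \<delta> * log 2 (real M) < log 2 (real M)" by (simp add: algebra_simps)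
    have "\<kappa> * real M \<le> sqrt P" using M(2) \<kappa> by (simp add: pos_le_divide_eq mult.commute)
    note code = ach[OF M(1) this _ _ rU re]
    show "achievable_rates \<rho> \<rho>\<^sub>f N P (\<theta>\<^sub>U * (1/2 * log 2 P)) (\<theta>\<^sub>e * (\<rho> * (1 - \<rho>\<^sub>f)) * (1/2 * log 2 P))"
      unfolding achievable_rates_def u_def[symmetric]
    proof (intro conjI exI[of _ "\<lambda>_ _. \<theta>\<^sub>e * u"] code)
      show "\<theta>\<^sub>e * (\<rho> * (1 - \<rho>\<^sub>f)) * u \<le> measure_pmf.expectation (activity_pmf \<rho> \<rho>\<^sub>f N)
          (\<lambda>s. 1 / real (ncells N) * (\<Sum>k\<in>embb N s. \<theta>\<^sub>e * u))"
        using expected_embb_rate[OF \<rho> N(1), of "\<theta>\<^sub>e * u"] by (simp only:) (simp add: mult_ac)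
    qed (use \<theta> \<rho> u in auto)
  qed
qed

text \<open>At rate 0 the only message is 1, so silence and decoders that always answer 1 never err.
  This fills in the powers too small for the scheme.\<close>

lemma achievable_rates_zero:
  assumes "0 \<le> P"
  shows "achievable_rates \<rho> \<rho>\<^sub>f N P 0 0"
proof -
  define c where "c = \<lparr>tx_coop = \<lambda>_ _ _ _ _ _. 0, encode = \<lambda>_ _ _ _ _. 0, urllc_decode = \<lambda>_ _ _. 1,
    rx_coop = \<lambda>_ _ _ _ _ _ _. 0, embb_decode = \<lambda>_ _ _ _. 1\<rparr>"
  have "wrong_at N n c 0 0 s m k = {}"
    if "(s, m) \<in> set_pmf (source_pmf \<rho> \<rho>\<^sub>f N n 0 (\<lambda>_ _. 0))" "k \<in> active N s" for n s m k
    using source_message[OF that(1) _ _ that(2)] by (auto simp: wrong_at_def decision_def c_def)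
  note right = this
  have "error_prob \<rho> \<rho>\<^sub>f N n 0 (\<lambda>_ _. 0) 0 0 c \<le> 0" for n
    by (rule error_prob_le) (simp add: right)
  then have "error_prob \<rho> \<rho>\<^sub>f N n 0 (\<lambda>_ _. 0) 0 0 c = 0" for n
    using error_prob_nonneg by (rule antisym)
  moreover have "errors_measurable \<rho> \<rho>\<^sub>f N n 0 (\<lambda>_ _. 0) 0 0 c" for n
    by (auto simp: errors_measurable_def right)
  moreover have "power_constraint \<rho> \<rho>\<^sub>f N P n 0 (\<lambda>_ _. 0) 0 c" for n
    using assms by (auto simp: power_constraint_def channel_input_def c_def)
  ultimately show ?thesis
    unfolding achievable_rates_def
    by (intro conjI exI[of _ "\<lambda>_ _. 0"] exI[of _ 0] exI[of _ "\<lambda>_. c"]) auto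
qed

section \<open>Multiplexing gains and passage to the closure\<close>

lemma mg_eventually_linear:
  assumes "\<And>K. 1 \<le> K \<Longrightarrow> \<forall>\<^sub>F P in at_top. R K P = \<theta> * (1/2 * log 2 P)"
  shows "mg R = ereal \<theta>"
proof -
  have "Limsup at_top (\<lambda>P. ereal (R K P / (1/2 * log 2 P))) = ereal \<theta>" if "1 \<le> K" for K
  proof (rule lim_imp_Limsup)
    have "\<forall>\<^sub>F P in at_top. ereal (R K P / (1/2 * log 2 P)) = ereal \<theta>"
      using assms[OF that] eventually_gt_at_top[of 1]
    proof eventually_elim
      case (elim P)
      then have "0 < log 2 P" by (intro zero_less_log_cancel_iff[THEN iffD2]) auto
      then show ?case unfolding elim(1) by simp
    qed
    then show "((\<lambda>P. ereal (R K P / (1/2 * log 2 P))) \<longlongrightarrow> ereal \<theta>) at_top" by (rule tendsto_eventually)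
  qed simp
  then have "\<forall>\<^sub>F K in sequentially. Limsup at_top (\<lambda>P. ereal (R K P / (1/2 * log 2 P))) = ereal \<theta>"
    by (auto simp: eventually_sequentially)
  then show ?thesis unfolding mg_def
    by (intro lim_imp_Limsup tendsto_eventually) auto
qed

text \<open>The power threshold may depend on \<open>K\<close>, because the limit in
  \<open>P\<close> is taken first; below it zero rates are used.\<close>

lemma achievable_mg_interior:
  assumes \<rho>: "0 \<le> \<rho>" "\<rho> \<le> 1" "0 \<le> \<rho>\<^sub>f" "\<rho>\<^sub>f \<le> 1"
    and N: "\<And>K. 1 \<le> K \<Longrightarrow> ncells (Net K) = K" "\<And>K. 1 \<le> K \<Longrightarrow> nondegenerate (Net K)"
    and \<theta>: "0 \<le> \<theta>\<^sub>U" "\<theta>\<^sub>U < 1/3" "0 \<le> \<theta>\<^sub>e" "\<theta>\<^sub>e < 1"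
  shows "achievable_mg \<rho> \<rho>\<^sub>f Net (\<rho> * \<rho>\<^sub>f * \<theta>\<^sub>U) (\<theta>\<^sub>e * (\<rho> * (1 - \<rho>\<^sub>f)))"
proof -
  have "\<forall>K. \<exists>P0. 1 \<le> K \<longrightarrow> (\<forall>P\<ge>P0. achievable_rates \<rho> \<rho>\<^sub>f (Net K) P
      (\<theta>\<^sub>U * (1/2 * log 2 P)) (\<theta>\<^sub>e * (\<rho> * (1 - \<rho>\<^sub>f)) * (1/2 * log 2 P)))"
    using achievable_rates_high_power[OF \<rho> _ N(2) \<theta>] N(1) by auto
  from choice[OF this] obtain P0 where P0: "\<And>K P. 1 \<le> K \<Longrightarrow> P0 K \<le> P \<Longrightarrow> achievable_rates \<rho> \<rho>\<^sub>f (Net K) P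
      (\<theta>\<^sub>U * (1/2 * log 2 P)) (\<theta>\<^sub>e * (\<rho> * (1 - \<rho>\<^sub>f)) * (1/2 * log 2 P))"
    by blast
  let ?R = "\<lambda>\<theta> K P. if P0 K \<le> P then \<theta> * (1/2 * log 2 P) else 0"
  have "mg (?R \<theta>) = ereal \<theta>" for \<theta>
  proof (rule mg_eventually_linear)
    show "\<forall>\<^sub>F P in at_top. ?R \<theta> K P = \<theta> * (1/2 * log 2 P)" for K
      using eventually_ge_at_top[of "P0 K"] by eventually_elim simp
  qed
  then show ?thesis unfolding achievable_mg_def
    using P0 achievable_rates_zero
    by (intro exI[of _ "?R \<theta>\<^sub>U"] exI[of _ "?R (\<theta>\<^sub>e * (\<rho> * (1 - \<rho>\<^sub>f)))"]) auto
qed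

theorem proposition6:
  fixes \<rho> \<rho>\<^sub>f :: real and Net :: "nat \<Rightarrow> hex_network"
  assumes "0 < \<rho>" and "\<rho> \<le> 1" and "0 \<le> \<rho>\<^sub>f" and "\<rho>\<^sub>f \<le> 1"
    and "\<And>K. 1 \<le> K \<Longrightarrow> ncells (Net K) = K"
    and "\<And>K. 1 \<le> K \<Longrightarrow> hexagonal_network (Net K)"
    and "\<And>K. 1 \<le> K \<Longrightarrow> nondegenerate (Net K)"
  shows "{(SU, Se). 0 \<le> SU \<and> 0 \<le> Se \<and> SU \<le> \<rho> * \<rho>\<^sub>f / 3 \<and> Se \<le> \<rho> * (1 - \<rho>\<^sub>f)}
           \<subseteq> mg_region \<rho> \<rho>\<^sub>f Net"
proof (clarify, goal_cases)
  case (1 SU Se)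
  \<comment> \<open>If a denominator is 0, the bound forces \<open>SU\<close> or \<open>Se\<close>
    to be 0, and division by zero returning 0 keeps the product identities true.\<close>
  define \<theta>\<^sub>U where "\<theta>\<^sub>U = SU / (\<rho> * \<rho>\<^sub>f)"
  define \<theta>\<^sub>e where "\<theta>\<^sub>e = Se / (\<rho> * (1 - \<rho>\<^sub>f))"
  have U: "0 \<le> \<theta>\<^sub>U" "\<theta>\<^sub>U \<le> 1/3" "\<rho> * \<rho>\<^sub>f * \<theta>\<^sub>U = SU"
    using 1 assms(1-4) by (auto simp: \<theta>\<^sub>U_def divide_simps mult_ac)
  have e: "0 \<le> \<theta>\<^sub>e" "\<theta>\<^sub>e \<le> 1" "\<theta>\<^sub>e * (\<rho> * (1 - \<rho>\<^sub>f)) = Se"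
    using 1 assms(1-4) by (auto simp: \<theta>\<^sub>e_def divide_simps mult_ac)
  \<comment> \<open>Factors below 1 move the point to where the bounds are strict; they tend to 1,
    and the closure takes in the limit.\<close>
  define \<tau> where "\<tau> = (\<lambda>i. real i / real (Suc i))"
  have "achievable_mg \<rho> \<rho>\<^sub>f Net (\<tau> i * SU) (\<tau> i * Se)" for i
  proof -
    have \<tau>: "0 \<le> \<tau> i" "\<tau> i < 1" by (auto simp: \<tau>_def)
    have "\<tau> i * \<theta>\<^sub>U < 1/3"
      using \<tau> U mult_left_mono[of \<theta>\<^sub>U "1/3" "\<tau> i"] by linarith
    moreover have "\<tau> i * \<theta>\<^sub>e < 1"
      using \<tau> e mult_left_mono[of \<theta>\<^sub>e 1 "\<tau> i"] by linarith
    ultimately have "achievable_mg \<rho> \<rho>\<^sub>f Net (\<rho> * \<rho>\<^sub>f * (\<tau> i * \<theta>\<^sub>U)) (\<tau> i * \<theta>\<^sub>e * (\<rho> * (1 - \<rho>\<^sub>f)))"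
      using assms \<tau> U(1) e(1) by (intro achievable_mg_interior) auto
    moreover have "\<rho> * \<rho>\<^sub>f * (\<tau> i * \<theta>\<^sub>U) = \<tau> i * SU" "\<tau> i * \<theta>\<^sub>e * (\<rho> * (1 - \<rho>\<^sub>f)) = \<tau> i * Se"
      by (simp_all add: U(3)[symmetric] e(3)[symmetric])
    ultimately show ?thesis by simp
  qed
  then have "\<forall>i. (\<tau> i * SU, \<tau> i * Se) \<in> {(SU, Se). achievable_mg \<rho> \<rho>\<^sub>f Net SU Se}" by simp
  moreover have "\<tau> \<longlonglongrightarrow> 1" unfolding \<tau>_def by (rule LIMSEQ_n_over_Suc_n)
  then have "(\<lambda>i. (\<tau> i * SU, \<tau> i * Se)) \<longlonglongrightarrow> (1 * SU, 1 * Se)" by (intro tendsto_intros)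
  ultimately show ?case unfolding mg_region_def closure_sequential by (intro exI[of _ "\<lambda>i. (\<tau> i * SU, \<tau> i * Se)"]) simp
qed

end
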